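(* Assume there exist $\lambda_0>0$ and strictly positive functions $\psi_0\in\mathrm{Dom}(L)$, $\phi_0\in\mathrm{Dom}(L^* )$ with $\int_D\psi_0\,dx=\int_D\phi_0\,dx=1$ such that, for all $t\ge0$, $P^D_t\psi_0=e^{-\lambda_0t}\psi_0$, $(P^D)^*_t\phi_0=e^{-\lambda_0t}\phi_0$, hence $(L+\lambda_0)\psi_0=(L^*+\lambda_0)\phi_0=0$. Let $g(z)\ge Cz^{1+\beta}$ for all $z>0$, where $C>0$, $\beta>0$ are given constants, let $$\tau^*=\inf\Big\{t>0:\int_0^t\exp\big[-\beta(\lambda_0K(r)+A(r))+\beta N_r\big]\,dr\ \ge\ \frac1{C\beta}\langle\varphi,\phi_0\rangle_D^{-\beta}\Big\},$$ and let $T>0$. 1. Assume that $B^H_t=\int_0^tK^H(t,s)\,dW_s$, where $W$ is a Brownian motion defined on the same probability space, and adapted to the same filtration, as the Brownian motion $B$. Then $$\mathbb P(\tau^*\le T)\le C\beta\langle\varphi,\phi_0\rangle_D^{\beta}\int_0^T\Big[e^{-\beta\lambda_0\int_0^tk^2(s)\,ds+2\beta^2\int_0^ta^2(s)\,ds}+e^{-\beta\int_0^ta^2(s)\,ds+4\beta^2Ht^{2H-1}\int_0^tb^2(s)\,ds}\Big]dt.$$ 2. If $B$ and $B^H$ are independent, then $$\mathbb P(\tau^*\le T)\le C\beta\langle\varphi,\phi_0\rangle_D^{\beta}\int_0^Te^{-\beta\lambda_0K(t)+\frac{\beta^2-\beta}{2}\int_0^ta^2(s)\,ds+\beta^2H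t^{2H-1}\int_0^tb^2(s)\,ds}\,dt.$$
   Context: $D\subset\mathbb{R}^d$ is a bounded Lipschitz domain, $\langle\cdot,\cdot\rangle_D$ the scalar product of $L^2(D)$. $L$ is the infinitesimal generator of a strongly continuous semigroup of contractions $(P^D_t)_{t\ge0}$ on $L^2(D)$ with adjoint $L^*$ generating $((P^D)^*_t)_{t\ge0}$; the associated transition functions admit continuous densities on $D\times D$ for $t>0$. $\varphi\in L^\infty(D)$, $\varphi\ge0$; $g:\mathbb{R}\to[0,\infty)$ is locally Lipschitz. On a filtered probability space $(\Omega,\mathcal F,(\mathcal F_t)_{t\ge0},\mathbb P)$, $B$ is a Brownian motion and $B^H$ a fractional Brownian motion with Hurst parameter $H\in(1/2,1)$, both adapted. $a$ is continuous, $b$ is Hölder continuous of order $\alpha>1-H$, $k$ is a real function on $[0,\infty)$ with $\int_0^tk^2(r)\,dr<\infty$ for all $t$, and $N_t=\int_0^t a(s)\,dB_s+\int_0^t b(s)\,dB^H_s$ (Itô integral plus fractional, i.e. generalized Riemann–Stieltjes, integral). $K(t)=\frac12\int_0^tk^2(r)\,dr$, $A(t)=\frac12\int_0^ta^2(r)\,dr$. The kernel is $K^H(t,s)=C_Hs^{1/2-H}\int_s^t(\sigma-s)^{H-3/2}\sigma^{H-1/2}\,d\sigma$ if $t>s$, and $K^H(t,s)=0$ if $t\le s$, where $C_H=\big[\frac{H(2H-1)}{\mathcal B(2-2H,H-1/2)}\big]^{1/2}$ and $\mathcal B$ is the beta function. Background: $\tau^*$ is the upper bound for the blowup time of the weak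 solution of $du(x,t)=[\frac12k^2(t)Lu(x,t)+g(u(x,t))]dt+u(x,t)\,dN_t$ on $D$ with $u(\cdot,0)=\varphi$ and $u=0$ on $\partial D$. Conventions: $\inf\emptyset=+\infty$, $0^{-\beta}=+\infty$. *)

theory Defs
  imports "HOL-Probability.Probability"
begin

section \<open>Lipschitz domains\<close>

text \<open>Near each boundary point, \<open>D\<close> is the region above a Lipschitz graph over the hyperplane
  orthogonal to some unit vector \<open>e\<close>.\<close>

definition lipschitz_boundary :: "'d::euclidean_space set \<Rightarrow> bool" where
  "lipschitz_boundary D \<longleftrightarrow>
     (\<forall>p\<in>frontier D. \<exists>r>0. \<exists>e. norm e = 1 \<and>
        (\<exists>\<gamma> c. c-lipschitz_on {y. y \<bullet> e = 0} \<gamma> \<and>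
           D \<inter> ball p r = {x \<in> ball p r. \<gamma> (x - (x \<bullet> e) *\<^sub>R e) < x \<bullet> e}))"

definition bounded_lipschitz_domain :: "'d::euclidean_space set \<Rightarrow> bool" where
  "bounded_lipschitz_domain D \<longleftrightarrow>
     open D \<and> connected D \<and> D \<noteq> {} \<and> bounded D \<and> lipschitz_boundary D"

definition locally_lipschitz :: "(real \<Rightarrow> real) \<Rightarrow> bool" where
  "locally_lipschitz g \<longleftrightarrow> (\<forall>x. \<exists>e>0. \<exists>c. c-lipschitz_on (cball x e) g)"

section \<open>The Hilbert space of square integrable functions and semigroups on it\<close>

text \<open>Elements of \<open>L\<^sup>2(D)\<close> are represented by square integrable functions; functions
  that agree almost everywhere represent the same element.\<close>

abbreviation leb :: "'d::euclidean_space set \<Rightarrow> 'd measure" where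
  "leb D \<equiv> restrict_space lborel D"

definition L2 :: "'d::euclidean_space set \<Rightarrow> ('d \<Rightarrow> real) set" where
  "L2 D = {f \<in> borel_measurable (leb D). integrable (leb D) (\<lambda>x. (f x)\<^sup>2)}"

definition Linfty :: "'d::euclidean_space set \<Rightarrow> ('d \<Rightarrow> real) set" where
  "Linfty D = {f \<in> borel_measurable (leb D). \<exists>c. AE x in leb D. \<bar>f x\<bar> \<le> c}"

definition ip :: "'d::euclidean_space set \<Rightarrow> ('d \<Rightarrow> real) \<Rightarrow> ('d \<Rightarrow> real) \<Rightarrow> real" where
  "ip D f h = (LINT x|leb D. f x * h x)"

definition L2norm :: "'d::euclidean_space set \<Rightarrow> ('d \<Rightarrow> real) \<Rightarrow> real" where
  "L2norm D f = sqrt (ip D f f)"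

definition contraction_semigroup ::
  "'d::euclidean_space set \<Rightarrow> (real \<Rightarrow> ('d \<Rightarrow> real) \<Rightarrow> ('d \<Rightarrow> real)) \<Rightarrow> bool" where
  "contraction_semigroup D P \<longleftrightarrow>
     (\<forall>t\<ge>0. \<forall>f\<in>L2 D. P t f \<in> L2 D \<and> L2norm D (P t f) \<le> L2norm D f) \<and>
     (\<forall>t\<ge>0. \<forall>f\<in>L2 D. \<forall>h\<in>L2 D. \<forall>c d.
        AE x in leb D. P t (\<lambda>y. c * f y + d * h y) x = c * P t f x + d * P t h x) \<and>
     (\<forall>f\<in>L2 D. AE x in leb D. P 0 f x = f x) \<and>
     (\<forall>s\<ge>0. \<forall>t\<ge>0. \<forall>f\<in>L2 D. AE x in leb D. P (s + t) f x = P s (P t f) x) \<and>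
     (\<forall>f\<in>L2 D. ((\<lambda>t. L2norm D (\<lambda>x. P t f x - f x)) \<longlongrightarrow> 0) (at_right 0))"

text \<open>Unbounded operators are represented by their graphs, so that \<^term>\<open>Domain L\<close> is the
  domain of \<open>L\<close>.\<close>

definition generator ::
  "'d::euclidean_space set \<Rightarrow> (real \<Rightarrow> ('d \<Rightarrow> real) \<Rightarrow> ('d \<Rightarrow> real)) \<Rightarrow> ('d \<Rightarrow> real) rel" where
  "generator D P = {(f, h). f \<in> L2 D \<and> h \<in> L2 D \<and>
     ((\<lambda>t. L2norm D (\<lambda>x. (P t f x - f x) / t - h x)) \<longlongrightarrow> 0) (at_right 0)}"

definition adjoint_operator ::
  "'d::euclidean_space set \<Rightarrow> ('d \<Rightarrow> real) rel \<Rightarrow> ('d \<Rightarrow> real) rel" where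
  "adjoint_operator D L = {(f, h). f \<in> L2 D \<and> h \<in> L2 D \<and>
     (\<forall>(u, v)\<in>L. ip D v f = ip D u h)}"

definition adjoint_semigroup ::
  "'d::euclidean_space set \<Rightarrow> (real \<Rightarrow> ('d \<Rightarrow> real) \<Rightarrow> ('d \<Rightarrow> real)) \<Rightarrow>
   (real \<Rightarrow> ('d \<Rightarrow> real) \<Rightarrow> ('d \<Rightarrow> real)) \<Rightarrow> bool" where
  "adjoint_semigroup D P Q \<longleftrightarrow>
     (\<forall>t\<ge>0. \<forall>f\<in>L2 D. \<forall>h\<in>L2 D. ip D (P t f) h = ip D f (Q t h))"

text \<open>A sub-Markovian transition function \<open>\<kappa>\<close> (satisfying the Chapman-Kolmogorov equations) that
  represents the operators \<open>P t\<close>.\<close>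

definition transition_function ::
  "'d::euclidean_space set \<Rightarrow> (real \<Rightarrow> ('d \<Rightarrow> real) \<Rightarrow> ('d \<Rightarrow> real)) \<Rightarrow>
   (real \<Rightarrow> 'd \<Rightarrow> 'd measure) \<Rightarrow> bool" where
  "transition_function D P \<kappa> \<longleftrightarrow>
     (\<forall>t>0. \<kappa> t \<in> leb D \<rightarrow>\<^sub>M subprob_algebra (leb D)) \<and>
     (\<forall>s>0. \<forall>t>0. \<forall>x\<in>D. \<kappa> (s + t) x = \<kappa> s x \<bind> \<kappa> t) \<and>
     (\<forall>t>0. \<forall>f\<in>L2 D. AE x in leb D.
        integrable (\<kappa> t x) f \<and> P t f x = (LINT y|\<kappa> t x. f y))"

definition has_continuous_transition_densities ::
  "'d::euclidean_space set \<Rightarrow> (real \<Rightarrow> ('d \<Rightarrow> real) \<Rightarrow> ('d \<Rightarrow> real)) \<Rightarrow> bool" where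
  "has_continuous_transition_densities D P \<longleftrightarrow>
     (\<exists>\<kappa> p. transition_function D P \<kappa> \<and>
        (\<forall>t>0. continuous_on (D \<times> D) (\<lambda>(x, y). p t x y) \<and>
           (\<forall>x\<in>D. (\<forall>y\<in>D. 0 \<le> p t x y) \<and>
              \<kappa> t x = density (leb D) (\<lambda>y. ennreal (p t x y)))))"

section \<open>Brownian motion and fractional Brownian motion\<close>

definition filtered_prob_space :: "'w measure \<Rightarrow> (real \<Rightarrow> 'w measure) \<Rightarrow> bool" where
  "filtered_prob_space M F \<longleftrightarrow> prob_space M \<and>
     (\<forall>t\<ge>0. subalgebra M (F t)) \<and> (\<forall>s\<ge>0. \<forall>t\<ge>s. subalgebra (F t) (F s))"

definition adapted_process :: "(real \<Rightarrow> 'w measure) \<Rightarrow> (real \<Rightarrow> 'w \<Rightarrow> real) \<Rightarrow> bool" where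
  "adapted_process F X \<longleftrightarrow> (\<forall>t\<ge>0. X t \<in> borel_measurable (F t))"

definition brownian_motion ::
  "'w measure \<Rightarrow> (real \<Rightarrow> 'w measure) \<Rightarrow> (real \<Rightarrow> 'w \<Rightarrow> real) \<Rightarrow> bool" where
  "brownian_motion M F B \<longleftrightarrow>
     adapted_process F B \<and>
     (AE \<omega> in M. B 0 \<omega> = 0) \<and>
     (\<forall>s\<ge>0. \<forall>t>s.
        distributed M lborel (\<lambda>\<omega>. B t \<omega> - B s \<omega>) (\<lambda>x. ennreal (normal_density 0 (sqrt (t - s)) x)) \<and>
        prob_space.indep_set M (sets (F s))
          (sets (vimage_algebra (space M) (\<lambda>\<omega>. B t \<omega> - B s \<omega>) borel))) \<and>
     (AE \<omega> in M. continuous_on {0..} (\<lambda>t. B t \<omega>))"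

text \<open>Degenerate normal distributions are allowed.\<close>

definition gaussian_rv :: "'w measure \<Rightarrow> ('w \<Rightarrow> real) \<Rightarrow> bool" where
  "gaussian_rv M Y \<longleftrightarrow> Y \<in> borel_measurable M \<and>
     ((\<exists>\<mu>. AE \<omega> in M. Y \<omega> = \<mu>) \<or>
      (\<exists>\<mu> \<sigma>. \<sigma> > 0 \<and> distributed M lborel Y (\<lambda>x. ennreal (normal_density \<mu> \<sigma> x))))"

definition gaussian_process :: "'w measure \<Rightarrow> (real \<Rightarrow> 'w \<Rightarrow> real) \<Rightarrow> bool" where
  "gaussian_process M X \<longleftrightarrow>
     (\<forall>J c. finite J \<and> J \<subseteq> {0..} \<longrightarrow> gaussian_rv M (\<lambda>\<omega>. \<Sum>t\<in>J. c t * X t \<omega>))"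

definition fractional_brownian_motion ::
  "'w measure \<Rightarrow> real \<Rightarrow> (real \<Rightarrow> 'w \<Rightarrow> real) \<Rightarrow> bool" where
  "fractional_brownian_motion M H X \<longleftrightarrow>
     gaussian_process M X \<and>
     (\<forall>t\<ge>0. (LINT \<omega>|M. X t \<omega>) = 0) \<and>
     (\<forall>s\<ge>0. \<forall>t\<ge>0. (LINT \<omega>|M. X s \<omega> * X t \<omega>) =
        (s powr (2 * H) + t powr (2 * H) - \<bar>t - s\<bar> powr (2 * H)) / 2) \<and>
     (AE \<omega> in M. continuous_on {0..} (\<lambda>t. X t \<omega>))"

definition independent_processes ::
  "'w measure \<Rightarrow> (real \<Rightarrow> 'w \<Rightarrow> real) \<Rightarrow> (real \<Rightarrow> 'w \<Rightarrow> real) \<Rightarrow> bool" where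
  "independent_processes M X Y \<longleftrightarrow>
     prob_space.indep_var M
       (PiM {0..} (\<lambda>_. borel)) (\<lambda>\<omega>. \<lambda>t\<in>{0..}. X t \<omega>)
       (PiM {0..} (\<lambda>_. borel)) (\<lambda>\<omega>. \<lambda>t\<in>{0..}. Y t \<omega>)"

text \<open>The value of \<open>K\<^sup>H(t, 0)\<close> is immaterial; with the library convention \<open>0 powr x = 0\<close>
  it is \<open>0\<close>.\<close>

definition C_fbm :: "real \<Rightarrow> real" where
  "C_fbm H = sqrt (H * (2 * H - 1) / Beta (2 - 2 * H) (H - 1 / 2))"

definition K_fbm :: "real \<Rightarrow> real \<Rightarrow> real \<Rightarrow> real" where
  "K_fbm H t s =
     (if s < t then
        C_fbm H * s powr (1 / 2 - H) *
          (LINT \<sigma>:{s..t}|lborel. (\<sigma> - s) powr (H - 3 / 2) * \<sigma> powr (H - 1 / 2))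
      else 0)"

section \<open>Stochastic integrals\<close>

text \<open>A simple adapted process on \<open>[0, t]\<close> is given by grid points \<open>\<tau> 0 \<le> \<dots> \<le> \<tau> n\<close> and bounded
  values \<open>\<xi> i\<close>, measurable at time \<open>\<tau> i\<close> and attained on \<open>(\<tau> i, \<tau> (i + 1)]\<close>.\<close>

definition simple_adapted ::
  "'w measure \<Rightarrow> (real \<Rightarrow> 'w measure) \<Rightarrow> real \<Rightarrow> nat \<Rightarrow> (nat \<Rightarrow> real) \<Rightarrow> (nat \<Rightarrow> 'w \<Rightarrow> real) \<Rightarrow> bool" where
  "simple_adapted M F t n \<tau> \<xi> \<longleftrightarrow>
     0 \<le> \<tau> 0 \<and> \<tau> n \<le> t \<and>
     (\<forall>i<n. \<tau> i \<le> \<tau> (Suc i) \<and> \<xi> i \<in> borel_measurable (F (\<tau> i)) \<and> bounded (\<xi> i ` space M))"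

definition simple_path ::
  "nat \<Rightarrow> (nat \<Rightarrow> real) \<Rightarrow> (nat \<Rightarrow> 'w \<Rightarrow> real) \<Rightarrow> real \<Rightarrow> 'w \<Rightarrow> real" where
  "simple_path n \<tau> \<xi> s \<omega> = (\<Sum>i<n. \<xi> i \<omega> * indicator {\<tau> i<..\<tau> (Suc i)} s)"

definition simple_ito ::
  "(real \<Rightarrow> 'w \<Rightarrow> real) \<Rightarrow> nat \<Rightarrow> (nat \<Rightarrow> real) \<Rightarrow> (nat \<Rightarrow> 'w \<Rightarrow> real) \<Rightarrow> 'w \<Rightarrow> real" where
  "simple_ito B n \<tau> \<xi> \<omega> = (\<Sum>i<n. \<xi> i \<omega> * (B (\<tau> (Suc i)) \<omega> - B (\<tau> i) \<omega>))"

text \<open>The random variable \<open>X\<close> is a version of the Ito integral of \<open>\<Phi>\<close> with respect to \<open>B\<close> over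
  \<open>[0, t]\<close>: simple adapted processes converge to \<open>\<Phi>\<close> in \<open>L\<^sup>2([0, t] \<times> \<Omega>)\<close> and their integrals
  converge to \<open>X\<close> in \<open>L\<^sup>2(\<Omega>)\<close>.\<close>

definition has_ito_integral ::
  "'w measure \<Rightarrow> (real \<Rightarrow> 'w measure) \<Rightarrow> (real \<Rightarrow> 'w \<Rightarrow> real) \<Rightarrow> real \<Rightarrow>
   (real \<Rightarrow> 'w \<Rightarrow> real) \<Rightarrow> ('w \<Rightarrow> real) \<Rightarrow> bool" where
  "has_ito_integral M F B t \<Phi> X \<longleftrightarrow>
     (\<lambda>(s, \<omega>). \<Phi> s \<omega>) \<in> borel_measurable (leb {0..t} \<Otimes>\<^sub>M M) \<and>
     X \<in> borel_measurable M \<and>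
     (\<exists>n \<tau> \<xi>. (\<forall>m::nat. simple_adapted M F t (n m) (\<tau> m) (\<xi> m)) \<and>
        ((\<lambda>m. \<integral>\<^sup>+\<omega>. (\<integral>\<^sup>+s. ennreal ((simple_path (n m) (\<tau> m) (\<xi> m) s \<omega> - \<Phi> s \<omega>)\<^sup>2) \<partial>leb {0..t}) \<partial>M)
           \<longlonglongrightarrow> 0) \<and>
        ((\<lambda>m. \<integral>\<^sup>+\<omega>. ennreal ((simple_ito B (n m) (\<tau> m) (\<xi> m) \<omega> - X \<omega>)\<^sup>2) \<partial>M) \<longlonglongrightarrow> 0))"

text \<open>The Riemann-Stieltjes integral as the limit of Riemann-Stieltjes sums when the mesh of the
  tagged partition tends to \<open>0\<close>; the integrator need not be of bounded variation.\<close>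

definition has_rs_integral ::
  "(real \<Rightarrow> real) \<Rightarrow> (real \<Rightarrow> real) \<Rightarrow> real \<Rightarrow> real \<Rightarrow> real \<Rightarrow> bool" where
  "has_rs_integral f g u v I \<longleftrightarrow>
     (\<forall>e>0. \<exists>d>0. \<forall>p. p tagged_division_of {u..v} \<and> (\<forall>(x, K)\<in>p. diameter K < d) \<longrightarrow>
        \<bar>(\<Sum>(x, K)\<in>p. f x * (g (Sup K) - g (Inf K))) - I\<bar> < e)"

text \<open>A continuous version \<open>N\<close> of the process \<open>\<integral>\<^sub>0\<^sup>t a(s) dB\<^sub>s + \<integral>\<^sub>0\<^sup>t b(s) dX\<^sub>s\<close>, with the second
  integral defined pathwise.\<close>

definition mixed_noise ::
  "'w measure \<Rightarrow> (real \<Rightarrow> 'w measure) \<Rightarrow> (real \<Rightarrow> 'w \<Rightarrow> real) \<Rightarrow> (real \<Rightarrow> 'w \<Rightarrow> real) \<Rightarrow>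
   (real \<Rightarrow> real) \<Rightarrow> (real \<Rightarrow> real) \<Rightarrow> (real \<Rightarrow> 'w \<Rightarrow> real) \<Rightarrow> bool" where
  "mixed_noise M F B X a b N \<longleftrightarrow>
     (\<forall>t\<ge>0. N t \<in> borel_measurable M) \<and>
     (\<forall>\<omega>\<in>space M. continuous_on {0..} (\<lambda>t. N t \<omega>)) \<and>
     (\<exists>I J. \<forall>t\<ge>0.
        has_ito_integral M F B t (\<lambda>s \<omega>. a s) (I t) \<and>
        (AE \<omega> in M. has_rs_integral b (\<lambda>s. X s \<omega>) 0 t (J t \<omega>)) \<and>
        (AE \<omega> in M. N t \<omega> = I t \<omega> + J t \<omega>))"

definition locally_hoelder :: "real \<Rightarrow> (real \<Rightarrow> real) \<Rightarrow> bool" where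
  "locally_hoelder \<alpha> f \<longleftrightarrow>
     (\<forall>R. \<exists>c. \<forall>s\<in>{0..R}. \<forall>t\<in>{0..R}. \<bar>f s - f t\<bar> \<le> c * \<bar>s - t\<bar> powr \<alpha>)"

section \<open>The upper bound for the blowup time\<close>

definition sq_int :: "(real \<Rightarrow> real) \<Rightarrow> real \<Rightarrow> real" where
  "sq_int f t = (LINT r:{0..t}|lborel. (f r)\<^sup>2)"

definition half_sq_int :: "(real \<Rightarrow> real) \<Rightarrow> real \<Rightarrow> real" where
  "half_sq_int f t = sq_int f t / 2"

text \<open>\<open>q\<close> to the power \<open>-\<beta>\<close> with the convention that it is infinite for \<open>q = 0\<close>
  (whereas \<open>0 powr x = 0\<close> in the library).\<close>

definition neg_power :: "real \<Rightarrow> real \<Rightarrow> ennreal" where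
  "neg_power q \<beta> = (if q = 0 then \<infinity> else ennreal (q powr (- \<beta>)))"

definition blowup_bound ::
  "real \<Rightarrow> real \<Rightarrow> real \<Rightarrow> (real \<Rightarrow> real) \<Rightarrow> (real \<Rightarrow> real) \<Rightarrow> real \<Rightarrow> (real \<Rightarrow> real) \<Rightarrow> ereal" where
  "blowup_bound C \<beta> lam\<^sub>0 k a q n =
     Inf {ereal t | t. t > 0 \<and>
       (\<integral>\<^sup>+r\<in>{0..t}. ennreal (exp (- \<beta> * (lam\<^sub>0 * half_sq_int k r + half_sq_int a r) + \<beta> * n r)) \<partial>lborel)
         \<ge> ennreal (1 / (C * \<beta>)) * neg_power q \<beta>}"

end

theory Submission
  imports Defs
begin

text \<open>By continuity of the paths of \<open>N\<close>, the random time \<open>\<tau>\<^sup>*\<close> is at most \<open>T\<close> only if the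
  exponential functional \<open>\<integral>\<^sub>0\<^sup>T exp (- \<beta> (\<lambda>\<^sub>0 K(r) + A(r)) + \<beta> N\<^sub>r) dr\<close> has reached its threshold
  at time \<open>T\<close>. Markov's inequality and Tonelli's theorem then bound the probability by the time
  integral of the expectations of the integrand (\<open>prob_blowup_le\<close>), so everything comes down to
  exponential moments of \<open>N\<^sub>t = I\<^sub>t + J\<^sub>t\<close>, where \<open>I\<^sub>t = \<integral>\<^sub>0\<^sup>t a dB\<close> and \<open>J\<^sub>t = \<integral>\<^sub>0\<^sup>t b dB\<^sup>H\<close>.

  Both integrals are almost sure limits of left-point sums along uniform partitions, which are
  centered Gaussian. Fatou's lemma passes an upper bound for their exponential moments to the limit,
  so neither the law of \<open>I\<^sub>t\<close> nor that of \<open>J\<^sub>t\<close> has to be identified.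

  \<^item> For \<open>J\<^sub>t\<close>, convergence of the sums is the definition of the Riemann-Stieltjes integral. For
    \<open>H > 1/2\<close> the increments of \<open>B\<^sup>H\<close> are nonnegatively correlated, so \<open>2 b\<^sub>i b\<^sub>j \<le> b\<^sub>i\<^sup>2 + b\<^sub>j\<^sup>2\<close>
    bounds the variance of a sum by \<open>\<Sum>\<^sub>i b\<^sub>i\<^sup>2 Cov(\<Delta>\<^sub>i, B\<^sup>H\<^sub>t)\<close>, and the covariance of an
    increment over a step of length \<open>h\<close> with \<open>B\<^sup>H\<^sub>t\<close> is at most \<open>2 H t\<^sup>2\<^sup>H\<^sup>-\<^sup>1 h\<close>. Hence
    \<open>E exp (\<theta> J\<^sub>t) \<le> exp (\<theta>\<^sup>2 H t\<^sup>2\<^sup>H\<^sup>-\<^sup>1 \<integral>\<^sub>0\<^sup>t b\<^sup>2)\<close> (\<open>fbm_stieltjes_exp_le\<close>).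
  \<^item> For \<open>I\<^sub>t\<close>, the defining sequence of simple processes may be random. The Ito isometry for
    arbitrary finite families of intervals compares it with the deterministic left-point sums,
    which therefore converge to the same limit in mean square. Hence
    \<open>E exp (\<theta> I\<^sub>t) \<le> exp (\<theta>\<^sup>2/2 \<integral>\<^sub>0\<^sup>t a\<^sup>2)\<close> (\<open>ito_exp_le\<close>).

  In the first part, \<open>exp (x + y) \<le> exp (2 x) + exp (2 y)\<close> separates the two integrals at the price
  of doubling \<open>\<beta>\<close>. In the second part, the left-point sums of \<open>I\<^sub>t\<close> and \<open>J\<^sub>t\<close> are functions of the
  independent paths of \<open>B\<close> and \<open>B\<^sup>H\<close>, so the exponential moments multiply
  (\<open>ito_stieltjes_exp_le_indep\<close>).\<close>

section \<open>Exponential moments\<close>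

text \<open>Completing the square: the exponential factor shifts the mean of the normal density by
  \<open>\<theta> \<sigma>\<^sup>2\<close> and leaves a constant, and the shifted density again has mass one.\<close>

lemma nn_integral_exp_normal_density:
  assumes "\<sigma> > 0"
  shows "(\<integral>\<^sup>+x. ennreal (exp (\<theta> * x)) * ennreal (normal_density \<mu> \<sigma> x) \<partial>lborel) =
    ennreal (exp (\<theta> * \<mu> + \<theta>\<^sup>2 * \<sigma>\<^sup>2 / 2))"
proof -
  have tilt: "exp (\<theta> * x) * normal_density \<mu> \<sigma> x =
      exp (\<theta> * \<mu> + \<theta>\<^sup>2 * \<sigma>\<^sup>2 / 2) * normal_density (\<mu> + \<theta> * \<sigma>\<^sup>2) \<sigma> x" for x
  proof -
    have "\<theta> * x + - (x - \<mu>)\<^sup>2 / (2 * \<sigma>\<^sup>2) =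
        \<theta> * \<mu> + \<theta>\<^sup>2 * \<sigma>\<^sup>2 / 2 + - (x - (\<mu> + \<theta> * \<sigma>\<^sup>2))\<^sup>2 / (2 * \<sigma>\<^sup>2)"
      using assms by (simp add: field_simps power2_eq_square)
    then have "exp (\<theta> * x) * exp (- (x - \<mu>)\<^sup>2 / (2 * \<sigma>\<^sup>2)) =
        exp (\<theta> * \<mu> + \<theta>\<^sup>2 * \<sigma>\<^sup>2 / 2) * exp (- (x - (\<mu> + \<theta> * \<sigma>\<^sup>2))\<^sup>2 / (2 * \<sigma>\<^sup>2))"
      by (simp only: exp_add [symmetric])
    then show ?thesis
      by (simp add: normal_density_def)
  qed
  have "(\<integral>\<^sup>+x. ennreal (exp (\<theta> * x)) * ennreal (normal_density \<mu> \<sigma> x) \<partial>lborel) =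
      (\<integral>\<^sup>+x. ennreal (exp (\<theta> * \<mu> + \<theta>\<^sup>2 * \<sigma>\<^sup>2 / 2)) *
        ennreal (normal_density (\<mu> + \<theta> * \<sigma>\<^sup>2) \<sigma> x) \<partial>lborel)"
    by (simp add: ennreal_mult' [symmetric] tilt)
  also have "\<dots> = ennreal (exp (\<theta> * \<mu> + \<theta>\<^sup>2 * \<sigma>\<^sup>2 / 2))"
    using assms by (simp add: nn_integral_cmult nn_integral_eq_integral)
  finally show ?thesis .
qed

lemma nn_integral_exp_distributed_normal:
  assumes "distributed M lborel Y (\<lambda>x. ennreal (normal_density \<mu> \<sigma> x))" and "\<sigma> > 0"
  shows "(\<integral>\<^sup>+\<omega>. ennreal (exp (\<theta> * Y \<omega>)) \<partial>M) = ennreal (exp (\<theta> * \<mu> + \<theta>\<^sup>2 * \<sigma>\<^sup>2 / 2))"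
  using distributed_nn_integral [OF assms(1), of "\<lambda>x. ennreal (exp (\<theta> * x))"]
    nn_integral_exp_normal_density [OF assms(2), of \<theta> \<mu>]
  by (simp add: mult.commute)

lemma distributed_normal_square:
  assumes "distributed M lborel Y (\<lambda>x. ennreal (normal_density \<mu> \<sigma> x))" and "\<sigma> > 0"
  shows "integrable M Y" and "(LINT \<omega>|M. Y \<omega>) = \<mu>"
    and "integrable M (\<lambda>\<omega>. (Y \<omega>)\<^sup>2)" and "(LINT \<omega>|M. (Y \<omega>)\<^sup>2) = \<sigma>\<^sup>2 + \<mu>\<^sup>2"
proof -
  have "has_bochner_integral lborel (\<lambda>x. normal_density \<mu> \<sigma> x * x) \<mu>"
    by (rule normal_moment_nz_1 [OF assms(2)])
  then have 1: "integrable lborel (\<lambda>x. normal_density \<mu> \<sigma> x * x)"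
    "(LINT x|lborel. normal_density \<mu> \<sigma> x * x) = \<mu>"
    by (auto simp: has_bochner_integral_iff)
  then show "integrable M Y"
    using distributed_integrable [OF assms(1), of "\<lambda>x. x"] by simp
  show "(LINT \<omega>|M. Y \<omega>) = \<mu>"
    using distributed_integral [OF assms(1), of "\<lambda>x. x"] 1 by simp
  \<comment> \<open>The second moment is recovered from the variance by expanding the square.\<close>
  have "has_bochner_integral lborel (\<lambda>x. normal_density \<mu> \<sigma> x * (x - \<mu>) ^ (2 * 1))
      (fact (2 * 1) / ((2 / \<sigma>\<^sup>2) ^ 1 * fact 1))"
    by (rule normal_moment_even [OF assms(2)])
  then have "has_bochner_integral lborel (\<lambda>x. normal_density \<mu> \<sigma> x * (x - \<mu>)\<^sup>2) (\<sigma>\<^sup>2)"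
    by (simp add: fact_numeral)
  then have "has_bochner_integral lborel (\<lambda>x. normal_density \<mu> \<sigma> x * (x - \<mu>)\<^sup>2 +
      (2 * \<mu> * (normal_density \<mu> \<sigma> x * x) - \<mu>\<^sup>2 * normal_density \<mu> \<sigma> x)) (\<sigma>\<^sup>2 + (2 * \<mu> * \<mu> - \<mu>\<^sup>2 * 1))"
    using 1 assms(2) by (auto simp: has_bochner_integral_iff)
  moreover have "(\<lambda>x. normal_density \<mu> \<sigma> x * (x - \<mu>)\<^sup>2 +
      (2 * \<mu> * (normal_density \<mu> \<sigma> x * x) - \<mu>\<^sup>2 * normal_density \<mu> \<sigma> x)) =
      (\<lambda>x. normal_density \<mu> \<sigma> x * x\<^sup>2)"
    by (auto simp: fun_eq_iff power2_eq_square algebra_simps)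
  ultimately have 2: "integrable lborel (\<lambda>x. normal_density \<mu> \<sigma> x * x\<^sup>2)"
    "(LINT x|lborel. normal_density \<mu> \<sigma> x * x\<^sup>2) = \<sigma>\<^sup>2 + \<mu>\<^sup>2"
    by (auto simp: has_bochner_integral_iff power2_eq_square)
  then show "integrable M (\<lambda>\<omega>. (Y \<omega>)\<^sup>2)"
    using distributed_integrable [OF assms(1), of "\<lambda>x. x\<^sup>2"] by simp
  show "(LINT \<omega>|M. (Y \<omega>)\<^sup>2) = \<sigma>\<^sup>2 + \<mu>\<^sup>2"
    using distributed_integral [OF assms(1), of "\<lambda>x. x\<^sup>2"] 2 by simp
qed

lemma integrable_product_of_squares:
  fixes f g :: "'a \<Rightarrow> real"
  assumes [measurable]: "f \<in> borel_measurable M" "g \<in> borel_measurable M"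
    and int: "integrable M (\<lambda>\<omega>. (f \<omega>)\<^sup>2)" "integrable M (\<lambda>\<omega>. (g \<omega>)\<^sup>2)"
  shows "integrable M (\<lambda>\<omega>. f \<omega> * g \<omega>)"
proof -
  have "\<bar>x * y\<bar> \<le> x\<^sup>2 + y\<^sup>2" for x y :: real
  proof -
    have "0 \<le> (x + y)\<^sup>2" "0 \<le> (x - y)\<^sup>2" "0 \<le> x\<^sup>2 + y\<^sup>2"
      by simp_all
    then show ?thesis
      by (simp only: power2_sum power2_diff abs_le_iff) linarith
  qed
  then show ?thesis
    by (intro Bochner_Integration.integrable_bound
        [OF Bochner_Integration.integrable_add [OF int]]) auto
qed

lemma ennreal_tendsto_zeroI:
  fixes f :: "nat \<Rightarrow> ennreal"
  assumes "\<And>e::real. 0 < e \<Longrightarrow> \<forall>\<^sub>F n in sequentially. f n \<le> ennreal e"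
  shows "f \<longlonglongrightarrow> 0"
proof (rule order_tendstoI)
  fix y :: ennreal assume "0 < y"
  then obtain q where q: "0 < q" "q < y"
    using dense by blast
  then have "q < \<top>"
    by (metis less_top top.not_eq_extremum order.strict_trans)
  then have "ennreal (enn2real q) = q" "0 < enn2real q"
    using q by (auto simp: enn2real_positive_iff)
  with assms [of "enn2real q"] show "\<forall>\<^sub>F n in sequentially. f n < y"
    using q(2) by (auto elim: eventually_mono)
qed simp

context prob_space
begin

lemma gaussian_rv_square_integrable:
  assumes "gaussian_rv M Y"
  shows "integrable M Y" and "integrable M (\<lambda>\<omega>. (Y \<omega>)\<^sup>2)"
proof -
  have [measurable]: "Y \<in> borel_measurable M"
    using assms by (simp add: gaussian_rv_def)
  have "integrable M Y \<and> integrable M (\<lambda>\<omega>. (Y \<omega>)\<^sup>2)"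
    using assms unfolding gaussian_rv_def
  proof (elim conjE disjE exE)
    fix \<mu> assume "AE \<omega> in M. Y \<omega> = \<mu>"
    then have "AE \<omega> in M. norm (Y \<omega>) \<le> \<bar>\<mu>\<bar>" "AE \<omega> in M. norm ((Y \<omega>)\<^sup>2) \<le> \<mu>\<^sup>2"
      by (auto elim: AE_mp)
    then show ?thesis
      by (intro conjI integrable_const_bound) auto
  next
    fix \<mu> \<sigma> assume "0 < \<sigma>" "distributed M lborel Y (\<lambda>x. ennreal (normal_density \<mu> \<sigma> x))"
    then show ?thesis
      using distributed_normal_square by blast
  qed
  then show "integrable M Y" and "integrable M (\<lambda>\<omega>. (Y \<omega>)\<^sup>2)"
    by auto
qed

text \<open>The point is that degenerate distributions are included: for them both sides are \<open>1\<close>.\<close>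

lemma nn_integral_exp_centered_gaussian_rv:
  assumes "gaussian_rv M Y" and "expectation Y = 0"
  shows "(\<integral>\<^sup>+\<omega>. ennreal (exp (\<theta> * Y \<omega>)) \<partial>M) =
    ennreal (exp (\<theta>\<^sup>2 / 2 * expectation (\<lambda>\<omega>. (Y \<omega>)\<^sup>2)))"
proof -
  have [measurable]: "Y \<in> borel_measurable M"
    using assms by (simp add: gaussian_rv_def)
  show ?thesis
    using assms(1) unfolding gaussian_rv_def
  proof (elim conjE disjE exE)
    fix \<mu> assume \<mu>: "AE \<omega> in M. Y \<omega> = \<mu>"
    have "expectation Y = expectation (\<lambda>_. \<mu>)"
      using \<mu> by (intro integral_cong_AE) auto
    then have "AE \<omega> in M. Y \<omega> = 0"
      using \<mu> assms(2) by (simp add: prob_space)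
    then have "(\<integral>\<^sup>+\<omega>. ennreal (exp (\<theta> * Y \<omega>)) \<partial>M) = (\<integral>\<^sup>+\<omega>. 1 \<partial>M)"
      and "expectation (\<lambda>\<omega>. (Y \<omega>)\<^sup>2) = expectation (\<lambda>_. 0)"
      by (intro nn_integral_cong_AE integral_cong_AE; auto elim: AE_mp)+
    then show ?thesis
      by (simp add: emeasure_space_1)
  next
    fix \<mu> \<sigma> assume *: "0 < \<sigma>" "distributed M lborel Y (\<lambda>x. ennreal (normal_density \<mu> \<sigma> x))"
    then have "\<mu> = 0"
      using distributed_normal_square(2) assms(2) by metis
    then show ?thesis
      using nn_integral_exp_distributed_normal [OF *(2,1), of \<theta>]
        distributed_normal_square(4) [OF *(2,1)]
      by simp
  qed
qed

text \<open>Fatou's lemma, in the form in which it transports exponential moment bounds from approximating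
  sums to stochastic integrals.\<close>

lemma nn_integral_exp_limit_le:
  assumes [measurable]: "\<And>n. S n \<in> borel_measurable M"
    and lim: "AE \<omega> in M. (\<lambda>n. S n \<omega>) \<longlonglongrightarrow> Y \<omega>"
    and bound: "\<And>n. (\<integral>\<^sup>+\<omega>. ennreal (exp (S n \<omega>)) \<partial>M) \<le> ennreal (exp (v n))"
    and v: "v \<longlonglongrightarrow> V"
  shows "(\<integral>\<^sup>+\<omega>. ennreal (exp (Y \<omega>)) \<partial>M) \<le> ennreal (exp V)"
proof -
  have "AE \<omega> in M. ennreal (exp (Y \<omega>)) = liminf (\<lambda>n. ennreal (exp (S n \<omega>)))"
    using lim
  proof (eventually_elim)
    case (elim \<omega>)
    then have "(\<lambda>n. ennreal (exp (S n \<omega>))) \<longlonglongrightarrow> ennreal (exp (Y \<omega>))"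
      by (intro tendsto_ennrealI tendsto_exp)
    then show ?case
      by (intro lim_imp_Liminf [symmetric]) simp_all
  qed
  then have "(\<integral>\<^sup>+\<omega>. ennreal (exp (Y \<omega>)) \<partial>M) = (\<integral>\<^sup>+\<omega>. liminf (\<lambda>n. ennreal (exp (S n \<omega>))) \<partial>M)"
    by (rule nn_integral_cong_AE)
  also have "\<dots> \<le> liminf (\<lambda>n. \<integral>\<^sup>+\<omega>. ennreal (exp (S n \<omega>)) \<partial>M)"
    by (intro nn_integral_liminf) auto
  also have "\<dots> \<le> liminf (\<lambda>n. ennreal (exp (v n)))"
    using bound by (intro Liminf_mono) auto
  also have "\<dots> = ennreal (exp V)"
    using v by (intro lim_imp_Liminf tendsto_ennrealI tendsto_exp) auto
  finally show ?thesis .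
qed

lemma indep_var_nn_integral_mult:
  fixes X Y :: "'a \<Rightarrow> ennreal"
  assumes "indep_var borel X borel Y"
  shows "(\<integral>\<^sup>+\<omega>. X \<omega> * Y \<omega> \<partial>M) = (\<integral>\<^sup>+\<omega>. X \<omega> \<partial>M) * (\<integral>\<^sup>+\<omega>. Y \<omega> \<partial>M)"
proof -
  have "case_bool borel borel = (\<lambda>_. borel :: ennreal measure)"
    by (auto simp: fun_eq_iff split: bool.split)
  then have "indep_vars (\<lambda>_. borel) (case_bool X Y) UNIV"
    using assms by (simp add: indep_var_def)
  from indep_vars_nn_integral [OF _ this] show ?thesis
    by (simp add: UNIV_bool mult.commute)
qed

text \<open>The squares tend to \<open>0\<close> in the first mean, hence almost surely along a subsequence. An initial
  segment, on which the integrals might be infinite, is discarded.\<close>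

lemma L2_tendsto_AE_subseq:
  fixes f :: "nat \<Rightarrow> 'a \<Rightarrow> real"
  assumes [measurable]: "\<And>n. f n \<in> borel_measurable M" "g \<in> borel_measurable M"
    and lim: "(\<lambda>n. \<integral>\<^sup>+\<omega>. ennreal ((f n \<omega> - g \<omega>)\<^sup>2) \<partial>M) \<longlonglongrightarrow> 0"
  shows "\<exists>r. strict_mono r \<and> (AE \<omega> in M. (\<lambda>n. f (r n) \<omega>) \<longlonglongrightarrow> g \<omega>)"
proof -
  have "\<forall>\<^sub>F n in sequentially. (\<integral>\<^sup>+\<omega>. ennreal ((f n \<omega> - g \<omega>)\<^sup>2) \<partial>M) < 1"
    using order_tendstoD(2) [OF lim, of 1] by simp
  then obtain m where m: "\<And>n. m \<le> n \<Longrightarrow> (\<integral>\<^sup>+\<omega>. ennreal ((f n \<omega> - g \<omega>)\<^sup>2) \<partial>M) < 1"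
    by (auto simp: eventually_sequentially)
  define u where "u n \<omega> = (f (n + m) \<omega> - g \<omega>)\<^sup>2" for n \<omega>
  have u_int: "integrable M (u n)" for n
  proof (rule integrableI_nonneg)
    show "u n \<in> borel_measurable M"
      unfolding u_def by measurable
    show "(\<integral>\<^sup>+ x. ennreal (u n x) \<partial>M) < \<infinity>"
      using m [of "n + m"] unfolding u_def by (simp add: order.strict_trans)
  qed (simp add: u_def)
  have eq: "(\<integral>\<^sup>+\<omega>. ennreal ((f (n + m) \<omega> - g \<omega>)\<^sup>2) \<partial>M) = ennreal (\<integral>\<omega>. norm (u n \<omega>) \<partial>M)" for n
    using nn_integral_eq_integral [OF u_int, of n] by (simp add: u_def [abs_def])
  have "(\<lambda>n. \<integral>\<^sup>+\<omega>. ennreal ((f (n + m) \<omega> - g \<omega>)\<^sup>2) \<partial>M) \<longlonglongrightarrow> 0"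
    using LIMSEQ_ignore_initial_segment [OF lim, of m] .
  then have "(\<lambda>n. \<integral>\<omega>. norm (u n \<omega>) \<partial>M) \<longlonglongrightarrow> 0"
    unfolding eq ennreal_0 [symmetric] by (subst (asm) tendsto_ennreal_iff) auto
  from tendsto_L1_AE_subseq [OF u_int this]
  obtain r where r: "strict_mono r" "AE \<omega> in M. (\<lambda>n. u (r n) \<omega>) \<longlonglongrightarrow> 0"
    by blast
  have "strict_mono (\<lambda>n. r n + m)"
    using r(1) by (simp add: strict_mono_def)
  moreover have "AE \<omega> in M. (\<lambda>n. f (r n + m) \<omega>) \<longlonglongrightarrow> g \<omega>"
    using r(2)
  proof eventually_elim
    case (elim \<omega>)
    then have "(\<lambda>n. sqrt (u (r n) \<omega>)) \<longlonglongrightarrow> sqrt 0"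
      by (rule tendsto_real_sqrt)
    then have "(\<lambda>n. \<bar>f (r n + m) \<omega> - g \<omega>\<bar>) \<longlonglongrightarrow> 0"
      by (simp add: u_def)
    then show ?case
      by (simp add: tendsto_rabs_zero_iff LIM_zero_iff)
  qed
  ultimately show ?thesis
    by blast
qed

lemma integrable_bounded:
  fixes f :: "'a \<Rightarrow> real"
  assumes "f \<in> borel_measurable M" "bounded (f ` space M)"
  shows "integrable M f"
proof -
  obtain c where "\<And>x. x \<in> f ` space M \<Longrightarrow> norm x \<le> c"
    using assms(2) by (auto simp: bounded_iff)
  then have "AE \<omega> in M. norm (f \<omega>) \<le> c"
    by (intro AE_I2) auto
  then show ?thesis
    by (intro integrable_const_bound assms(1))
qed

lemma integrable_bounded_mult:
  fixes f g :: "'a \<Rightarrow> real"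
  assumes [measurable]: "f \<in> borel_measurable M" and "bounded (f ` space M)" and g: "integrable M g"
  shows "integrable M (\<lambda>\<omega>. f \<omega> * g \<omega>)"
proof -
  obtain c where c: "\<And>x. x \<in> f ` space M \<Longrightarrow> norm x \<le> c"
    using assms(2) by (auto simp: bounded_iff)
  have [measurable]: "g \<in> borel_measurable M"
    using g by simp
  have "integrable M (\<lambda>\<omega>. c * g \<omega>)"
    using g by simp
  then show ?thesis
  proof (rule Bochner_Integration.integrable_bound)
    show "AE \<omega> in M. norm (f \<omega> * g \<omega>) \<le> norm (c * g \<omega>)"
    proof (intro AE_I2)
      fix \<omega> assume "\<omega> \<in> space M"
      then have "\<bar>f \<omega>\<bar> \<le> \<bar>c\<bar>"
        using c [of "f \<omega>"] by simp
      then show "norm (f \<omega> * g \<omega>) \<le> norm (c * g \<omega>)"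
        by (simp add: abs_mult mult_right_mono)
    qed
  qed simp
qed

lemma bounded_image_mult:
  fixes f g :: "'a \<Rightarrow> real"
  assumes "bounded (f ` space M)" "bounded (g ` space M)"
  shows "bounded ((\<lambda>\<omega>. f \<omega> * g \<omega>) ` space M)"
proof -
  obtain c where c: "\<And>x. x \<in> f ` space M \<Longrightarrow> norm x \<le> c"
    using assms(1) by (auto simp: bounded_iff)
  obtain d where d: "\<And>x. x \<in> g ` space M \<Longrightarrow> norm x \<le> d"
    using assms(2) by (auto simp: bounded_iff)
  have "norm (f \<omega> * g \<omega>) \<le> c * d" if "\<omega> \<in> space M" for \<omega>
    unfolding norm_mult using c [of "f \<omega>"] d [of "g \<omega>"] that
    by (intro mult_mono) (auto intro: order_trans [OF abs_ge_zero])
  then show ?thesis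
    unfolding bounded_iff by auto
qed

end

section \<open>Left-point sums along uniform partitions\<close>

text \<open>By the mean value theorem for the primitive of \<open>f\<close>, each term differs from the integral over
  its cell by at most the oscillation of \<open>f\<close> on the cell times the length of the cell.\<close>

lemma left_riemann_sums_tendsto:
  fixes f :: "real \<Rightarrow> real" and t :: real
  assumes f: "continuous_on {0..t} f" and t: "0 < t"
  shows "(\<lambda>n. \<Sum>i<Suc n. f (t * i / Suc n) * (t / Suc n)) \<longlonglongrightarrow> (LINT s:{0..t}|lborel. f s)"
proof -
  define F where "F x = integral {0..x} f" for x
  have Fd: "(F has_real_derivative f x) (at x within {0..t})" if "x \<in> {0..t}" for x
    unfolding F_def using integral_has_real_derivative [OF f that] .
  have Ft: "F t = (LINT s:{0..t}|lborel. f s)"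
    unfolding F_def
    by (intro set_borel_integral_eq_integral(2) [symmetric] borel_integrable_atLeastAtMost')
      (use f in auto)
  have F0: "F 0 = 0"
    by (simp add: F_def)
  have uc: "uniformly_continuous_on {0..t} f"
    using f by (intro compact_uniformly_continuous) auto
  show ?thesis
    unfolding Ft [symmetric]
  proof (rule LIMSEQ_I)
    fix e :: real assume "0 < e"
    then have "0 < e / (2 * t)"
      using t by simp
    then obtain d where d: "d > 0"
      "\<And>x y. x \<in> {0..t} \<Longrightarrow> y \<in> {0..t} \<Longrightarrow> dist y x < d \<Longrightarrow> dist (f y) (f x) < e / (2 * t)"
      using uc unfolding uniformly_continuous_on_def by metis
    obtain n0 :: nat where n0: "t / d < n0"
      using reals_Archimedean2 by blast
    have "norm ((\<Sum>i<Suc n. f (t * i / Suc n) * (t / Suc n)) - F t) < e" if "n \<ge> n0" for n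
    proof -
      define h where "h = t / Suc n"
      define p where "p i = h * real i" for i
      have h: "0 < h"
        using t by (simp add: h_def)
      have "t / d < Suc n"
        using n0 that by simp
      then have "h < d"
        using d(1) by (simp add: h_def field_simps)
      have pn: "p (Suc n) = t" "p 0 = 0"
        by (simp_all add: p_def h_def)
      have ps: "p (Suc i) = p i + h" for i
        by (simp add: p_def algebra_simps)
      have pin: "0 \<le> p i" for i
        using h by (simp add: p_def)
      have pout: "p i \<le> t" if "i \<le> Suc n" for i
        using h that unfolding pn(1) [symmetric] p_def by (intro mult_left_mono) auto
      have step: "\<bar>f (p i) * h - (F (p (Suc i)) - F (p i))\<bar> \<le> e / (2 * t) * h" if i: "i < Suc n" for i
      proof -
        have sub: "{p i..p (Suc i)} \<subseteq> {0..t}"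
          using pin [of i] pout [of "Suc i"] i by auto
        have "\<exists>z\<in>{p i<..<p (Suc i)}. F (p (Suc i)) - F (p i) = f z * (p (Suc i) - p i)"
        proof (rule mvt_simple)
          show "p i < p (Suc i)"
            using h by (simp add: ps)
          fix x assume "p i \<le> x" "x \<le> p (Suc i)"
          then have "(F has_real_derivative f x) (at x within {p i..p (Suc i)})"
            using sub by (intro DERIV_subset [OF Fd]) auto
          then show "(F has_derivative (\<lambda>y. f x * y)) (at x within {p i..p (Suc i)})"
            by (simp add: has_field_derivative_def)
        qed
        then obtain z where z: "p i < z" "z < p (Suc i)" "F (p (Suc i)) - F (p i) = h * f z"
          by (auto simp: ps)
        have "dist (f z) (f (p i)) < e / (2 * t)"
          using z sub h \<open>h < d\<close> by (intro d) (auto simp: dist_real_def ps)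
        then have "\<bar>f (p i) - f z\<bar> * h \<le> e / (2 * t) * h"
          using h by (intro mult_right_mono) (auto simp: dist_real_def)
        moreover have "f (p i) * h - h * f z = (f (p i) - f z) * h"
          by (simp add: algebra_simps)
        ultimately show ?thesis
          using h by (simp add: z(3) abs_mult)
      qed
      have "(\<Sum>i<Suc n. f (t * i / Suc n) * (t / Suc n)) - F t =
          (\<Sum>i<Suc n. f (p i) * h - (F (p (Suc i)) - F (p i)))"
        using sum_lessThan_telescope [of "\<lambda>i. F (p i)" "Suc n"]
        by (simp add: sum_subtractf pn F0 p_def h_def del: sum.lessThan_Suc)
      also have "\<bar>\<dots>\<bar> \<le> (\<Sum>i<Suc n. e / (2 * t) * h)"
        using step by (intro order_trans [OF sum_abs] sum_mono) auto
      also have "\<dots> = e / 2"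
      proof -
        have "(\<Sum>i<Suc n. e / (2 * t) * h) = e / (2 * t) * (real (Suc n) * h)"
          by simp
        also have "real (Suc n) * h = t"
          unfolding h_def by (simp del: of_nat_Suc)
        finally show ?thesis
          using t by simp
      qed
      also have "\<dots> < e"
        using \<open>0 < e\<close> by simp
      finally show ?thesis
        by simp
    qed
    then show "\<exists>n0. \<forall>n\<ge>n0. norm ((\<Sum>i<Suc n. f (t * i / Suc n) * (t / Suc n)) - F t) < e"
      by blast
  qed
qed

text \<open>Left-point step functions approximate a continuous function uniformly. The cells are open on the
  left, as in the paths of simple processes, so the origin lies in none of them and is left out.\<close>

lemma left_step_close:
  fixes f :: "real \<Rightarrow> real" and t :: real
  assumes f: "continuous_on {0..t} f" and t: "0 < t" and e: "0 < e"
  shows "\<forall>\<^sub>F n in sequentially. \<forall>s\<in>{0<..t}.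
    \<bar>(\<Sum>i<Suc n. f (t * i / Suc n) * indicator {t * i / Suc n<..t * Suc i / Suc n} s) - f s\<bar> < e"
proof -
  have "uniformly_continuous_on {0..t} f"
    using f by (intro compact_uniformly_continuous) auto
  then obtain d where d: "d > 0"
    "\<And>x y. x \<in> {0..t} \<Longrightarrow> y \<in> {0..t} \<Longrightarrow> dist y x < d \<Longrightarrow> dist (f y) (f x) < e"
    using e unfolding uniformly_continuous_on_def by metis
  obtain n0 :: nat where n0: "t / d < n0"
    using reals_Archimedean2 by blast
  show ?thesis
    using eventually_ge_at_top [of n0]
  proof eventually_elim
    case (elim n)
    define h where "h = t / Suc n"
    define p where "p i = t * real i / Suc n" for i
    have h: "0 < h"
      using t by (simp add: h_def)
    have p_eq: "p i = h * i" for i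
      by (simp add: p_def h_def)
    have "t / d < Suc n"
      using n0 elim by simp
    then have hd: "h < d"
      using d(1) by (simp add: h_def field_simps)
    show ?case
    proof
      fix s assume s: "s \<in> {0<..t}"
      \<comment> \<open>The index of the cell that contains \<open>s\<close>.\<close>
      define k where "k = nat (\<lceil>s / h\<rceil> - 1)"
      have "0 < s / h"
        using s h by simp
      then have "1 \<le> \<lceil>s / h\<rceil>"
        by linarith
      then have rk: "real k = of_int \<lceil>s / h\<rceil> - 1"
        by (simp add: k_def)
      then have "real k < s / h" "s / h \<le> real k + 1"
        by linarith+
      then have ks: "h * k < s" "s \<le> h * Suc k"
        using h by (simp_all add: field_simps)
      have "h * k < h * Suc n"
        using ks s by (simp add: h_def)
      then have kn: "k < Suc n"
        using h by simp
      have "indicator {p i<..p (Suc i)} s = (if i = k then 1 else 0 :: real)" for i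
      proof -
        have "s \<le> h * i" if "k < i"
          using ks(2) h that by (intro order_trans [OF ks(2)] mult_left_mono) auto
        moreover have "h * Suc i < s" if "i < k"
          using ks(1) h that by (intro le_less_trans [OF _ ks(1)] mult_left_mono) auto
        ultimately show ?thesis
          using ks by (cases i k rule: linorder_cases) (auto simp: p_eq indicator_def simp del: of_nat_Suc)
      qed
      then have "(\<Sum>i<Suc n. f (p i) * indicator {p i<..p (Suc i)} s) = (\<Sum>i<Suc n. if i = k then f (p k) else 0)"
        by (intro sum.cong) auto
      also have "\<dots> = f (p k)"
        using kn by (simp add: sum.delta del: sum.lessThan_Suc)
      finally have sum_eq: "(\<Sum>i<Suc n. f (p i) * indicator {p i<..p (Suc i)} s) = f (p k)" .
      have "dist (f (p k)) (f s) < e"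
      proof (rule d(2))
        show "s \<in> {0..t}"
          using s by simp
        show "p k \<in> {0..t}"
          using ks s h by (simp add: p_eq)
        have "h * Suc k = h * k + h"
          by (simp add: algebra_simps)
        then show "dist (p k) s < d"
          using ks hd by (simp add: p_eq dist_real_def)
      qed
      then show "\<bar>(\<Sum>i<Suc n. f (t * i / Suc n) *
          indicator {t * i / Suc n<..t * Suc i / Suc n} s) - f s\<bar> < e"
        unfolding sum_eq [unfolded p_def] by (simp add: dist_real_def p_def)
    qed
  qed
qed

text \<open>Uniform partitions tagged at the left end points are admissible in the definition of the
  Riemann-Stieltjes integral, and their mesh tends to \<open>0\<close>.\<close>

lemma has_rs_integral_left_sums:
  fixes t :: real
  assumes rs: "has_rs_integral f g 0 t I" and t: "0 < t"
  shows "(\<lambda>n. \<Sum>i<Suc n. f (t * i / Suc n) * (g (t * Suc i / Suc n) - g (t * i / Suc n))) \<longlonglongrightarrow> I"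
proof (rule LIMSEQ_I)
  fix e :: real assume "0 < e"
  then obtain d where d0: "d > 0" and d1: "\<forall>p. p tagged_division_of {0..t} \<and>
      (\<forall>(x, K)\<in>p. diameter K < d) \<longrightarrow> \<bar>(\<Sum>(x, K)\<in>p. f x * (g (Sup K) - g (Inf K))) - I\<bar> < e"
    using rs [unfolded has_rs_integral_def, rule_format, OF \<open>0 < e\<close>] by (elim exE conjE)
  obtain n0 :: nat where n0: "t / d < n0"
    using reals_Archimedean2 by blast
  have "norm ((\<Sum>i<Suc n. f (t * i / Suc n) * (g (t * Suc i / Suc n) - g (t * i / Suc n))) - I) < e"
    if "n \<ge> n0" for n
  proof -
    define h where "h = t / Suc n"
    define x where "x i = h * real i" for i
    define p where "p = (\<lambda>i. (x i, {x i..x (Suc i)})) ` {..<Suc n}"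
    have h: "0 < h"
      using t by (simp add: h_def)
    have "t / d < Suc n"
      using n0 that by simp
    then have "h < d"
      using d0 by (simp add: h_def field_simps)
    have xn: "x (Suc n) = t" "x 0 = 0"
      by (simp_all add: x_def h_def)
    have xs: "x (Suc i) = x i + h" for i
      by (simp add: x_def algebra_simps)
    have xmono: "x i \<le> x j" if "i \<le> j" for i j
      using h that by (simp add: x_def)
    have inj: "inj_on (\<lambda>i. (x i, {x i..x (Suc i)})) {..<Suc n}"
      using h by (auto simp: inj_on_def x_def)
    have "p tagged_division_of {0..t}"
    proof (rule tagged_division_ofI)
      show "finite p"
        by (simp add: p_def)
      fix y K assume yK: "(y, K) \<in> p"
      then obtain i where i: "i < Suc n" "y = x i" "K = {x i..x (Suc i)}"
        by (auto simp: p_def)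
      show "y \<in> K"
        using h by (simp add: i xs)
      show "K \<subseteq> {0..t}"
        using xmono [of 0 i] xmono [of "Suc i" "Suc n"] i by (auto simp: xn)
      show "\<exists>a b. K = cbox a b"
        using i by auto
      fix y' K' assume "(y', K') \<in> p" and ne: "(y, K) \<noteq> (y', K')"
      then obtain j where j: "j < Suc n" "y' = x j" "K' = {x j..x (Suc j)}"
        by (auto simp: p_def)
      have "i \<noteq> j"
        using ne i j by auto
      then have "x (Suc i) \<le> x j \<or> x (Suc j) \<le> x i"
        using xmono [of "Suc i" j] xmono [of "Suc j" i] by linarith
      then show "interior K \<inter> interior K' = {}"
        by (auto simp: i j interior_atLeastAtMost_real)
    next
      have cover: "\<exists>i<Suc n. x i \<le> y \<and> y \<le> x (Suc i)" if "0 \<le> y" "y \<le> t" for y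
      proof -
        have "\<exists>i<m. x i \<le> y \<and> y \<le> x (Suc i)" if "0 \<le> y" "y \<le> x m" "m > 0" for m
          using that
        proof (induction m)
          case (Suc m)
          show ?case
          proof (cases "y \<le> x m \<and> 0 < m")
            case True
            then show ?thesis
              using Suc by (metis less_SucI)
          next
            case False
            then have "x m \<le> y"
              using Suc.prems xn(2) by (cases "m = 0") auto
            then show ?thesis
              using Suc.prems by auto
          qed
        qed simp
        from this [of "Suc n"] show ?thesis
          using that by (simp add: xn)
      qed
      have bounds: "x i \<ge> 0" "i < Suc n \<Longrightarrow> x (Suc i) \<le> t" for i
        using xmono [of 0 i] xmono [of "Suc i" "Suc n"] by (simp_all add: xn)
      have "(\<Union>i<Suc n. {x i..x (Suc i)}) = {0..t}"
      proof (intro equalityI subsetI)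
        fix y assume "y \<in> (\<Union>i<Suc n. {x i..x (Suc i)})"
        then obtain i where "i < Suc n" "x i \<le> y" "y \<le> x (Suc i)"
          by (auto simp del: lessThan_Suc)
        with bounds show "y \<in> {0..t}"
          by (meson atLeastAtMost_iff order_trans)
      next
        fix y assume "y \<in> {0..t}"
        then show "y \<in> (\<Union>i<Suc n. {x i..x (Suc i)})"
          using cover [of y] by (auto simp del: lessThan_Suc)
      qed
      moreover have "{K. \<exists>y. (y, K) \<in> p} = (\<lambda>i. {x i..x (Suc i)}) ` {..<Suc n}"
        by (auto simp: p_def simp del: lessThan_Suc)
      ultimately show "\<Union>{K. \<exists>y. (y, K) \<in> p} = {0..t}"
        by simp
    qed
    moreover have "\<forall>(y, K)\<in>p. diameter K < d"
    proof -
      have "diameter {x i..x (Suc i)} < d" for i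
        using h \<open>h < d\<close> by (simp add: xs)
      then show ?thesis
        unfolding p_def by blast
    qed
    ultimately have "\<bar>(\<Sum>(x, K)\<in>p. f x * (g (Sup K) - g (Inf K))) - I\<bar> < e"
      using d1 [rule_format, OF conjI] by simp
    also have "(\<Sum>(x, K)\<in>p. f x * (g (Sup K) - g (Inf K))) =
        (\<Sum>i<Suc n. f (x i) * (g (x (Suc i)) - g (x i)))"
      unfolding p_def using h by (subst sum.reindex [OF inj]) (simp add: xs cong: sum.cong)
    finally show ?thesis
      by (simp add: x_def h_def)
  qed
  then show "\<exists>n0. \<forall>n\<ge>n0. norm ((\<Sum>i<Suc n. f (t * i / Suc n) *
      (g (t * Suc i / Suc n) - g (t * i / Suc n))) - I) < e"
    by blast
qed

section \<open>Integrals with respect to fractional Brownian motion\<close>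

lemma powr_diff_le:
  fixes u v t p :: real
  assumes "0 \<le> u" "u \<le> v" "v \<le> t" "1 \<le> p"
  shows "v powr p - u powr p \<le> p * t powr (p - 1) * (v - u)"
proof (cases "u = v")
  case False
  then have "u < v"
    using assms by simp
  have "continuous_on {u..v} (\<lambda>x. x powr p)"
    using assms by (intro continuous_on_powr' continuous_intros) auto
  moreover have "((\<lambda>x. x powr p) has_derivative (\<lambda>y. p * x powr (p - 1) * y)) (at x)" if "u < x" for x
    using that assms has_real_derivative_powr [of x p] by (simp add: has_field_derivative_def)
  ultimately obtain \<xi> where \<xi>: "u < \<xi>" "\<xi> < v" "v powr p - u powr p = p * \<xi> powr (p - 1) * (v - u)"
    using mvt [OF \<open>u < v\<close>, of "\<lambda>x. x powr p" "\<lambda>x y. p * x powr (p - 1) * y"] by blast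
  then show ?thesis
    unfolding \<xi>(3) using assms by (intro mult_right_mono mult_left_mono powr_mono2) auto
qed simp

text \<open>Convexity of \<open>x\<^sup>p\<close>, in the form that decides the sign of covariances of fractional increments.\<close>

lemma powr_increment_mono:
  fixes x y \<delta> p :: real
  assumes "0 \<le> x" "x \<le> y" "0 \<le> \<delta>" "1 \<le> p"
  shows "(x + \<delta>) powr p - x powr p \<le> (y + \<delta>) powr p - y powr p"
proof (rule DERIV_nonneg_imp_increasing_open [OF \<open>x \<le> y\<close>])
  fix z assume "x < z" "z < y"
  then have "0 < z"
    using assms by simp
  then have "((\<lambda>z. (z + \<delta>) powr p - z powr p) has_real_derivative
      p * (z + \<delta>) powr (p - 1) - p * z powr (p - 1)) (at z)"
    using has_real_derivative_powr [of z p] DERIV_shift [of "\<lambda>z. z powr p" _ z \<delta>]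
      has_real_derivative_powr [of "z + \<delta>" p] assms
    by (intro DERIV_diff) auto
  moreover have "p * z powr (p - 1) \<le> p * (z + \<delta>) powr (p - 1)"
    using \<open>0 < z\<close> assms by (intro mult_left_mono powr_mono2) auto
  ultimately show "\<exists>d. ((\<lambda>z. (z + \<delta>) powr p - z powr p) has_real_derivative d) (at z) \<and> 0 \<le> d"
    by (intro exI conjI) (assumption, simp only: diff_ge_0_iff_ge)
next
  show "continuous_on {x..y} (\<lambda>z. (z + \<delta>) powr p - z powr p)"
    using assms by (intro continuous_intros continuous_on_powr') auto
qed

context prob_space
begin

context
  fixes H :: real and X :: "real \<Rightarrow> 'a \<Rightarrow> real"
  assumes fbm: "fractional_brownian_motion M H X" and H: "1 / 2 < H"
begin

lemma fbm_gaussian_rv: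
  assumes "0 \<le> t"
  shows "gaussian_rv M (X t)"
proof -
  have "gaussian_process M X"
    using fbm by (simp add: fractional_brownian_motion_def)
  from this [unfolded gaussian_process_def, rule_format, of "{t}" "\<lambda>_. 1"] assms
  show ?thesis
    by simp
qed

lemma fbm_measurable: "0 \<le> t \<Longrightarrow> X t \<in> borel_measurable M"
  using fbm_gaussian_rv by (simp add: gaussian_rv_def)

lemma fbm_integrable: "0 \<le> t \<Longrightarrow> integrable M (X t)"
  using fbm_gaussian_rv gaussian_rv_square_integrable by simp

lemma fbm_product:
  assumes "0 \<le> s" "0 \<le> t"
  shows "integrable M (\<lambda>\<omega>. X s \<omega> * X t \<omega>)"
    and "expectation (\<lambda>\<omega>. X s \<omega> * X t \<omega>) =
      (s powr (2 * H) + t powr (2 * H) - \<bar>t - s\<bar> powr (2 * H)) / 2"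
proof -
  show "integrable M (\<lambda>\<omega>. X s \<omega> * X t \<omega>)"
    using assms fbm_measurable fbm_gaussian_rv gaussian_rv_square_integrable
    by (intro integrable_product_of_squares) auto
  show "expectation (\<lambda>\<omega>. X s \<omega> * X t \<omega>) =
      (s powr (2 * H) + t powr (2 * H) - \<bar>t - s\<bar> powr (2 * H)) / 2"
    using fbm assms by (simp add: fractional_brownian_motion_def)
qed

lemma fbm_increment_product:
  assumes "0 \<le> u" "0 \<le> v" "0 \<le> p" "0 \<le> q"
  shows "integrable M (\<lambda>\<omega>. (X v \<omega> - X u \<omega>) * (X q \<omega> - X p \<omega>))"
    and "expectation (\<lambda>\<omega>. (X v \<omega> - X u \<omega>) * (X q \<omega> - X p \<omega>)) =
      (\<bar>q - u\<bar> powr (2 * H) + \<bar>p - v\<bar> powr (2 * H)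
        - \<bar>q - v\<bar> powr (2 * H) - \<bar>p - u\<bar> powr (2 * H)) / 2"
proof -
  have eq: "(\<lambda>\<omega>. (X v \<omega> - X u \<omega>) * (X q \<omega> - X p \<omega>)) =
      (\<lambda>\<omega>. X v \<omega> * X q \<omega> - X v \<omega> * X p \<omega> - X u \<omega> * X q \<omega> + X u \<omega> * X p \<omega>)"
    by (auto simp: fun_eq_iff algebra_simps)
  show "integrable M (\<lambda>\<omega>. (X v \<omega> - X u \<omega>) * (X q \<omega> - X p \<omega>))"
    unfolding eq using assms by (intro Bochner_Integration.integrable_add
        Bochner_Integration.integrable_diff fbm_product)
  show "expectation (\<lambda>\<omega>. (X v \<omega> - X u \<omega>) * (X q \<omega> - X p \<omega>)) =
      (\<bar>q - u\<bar> powr (2 * H) + \<bar>p - v\<bar> powr (2 * H)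
        - \<bar>q - v\<bar> powr (2 * H) - \<bar>p - u\<bar> powr (2 * H)) / 2"
    unfolding eq using assms by (simp add: fbm_product abs_minus_commute flip: diff_divide_distrib add_divide_distrib)
qed

text \<open>For disjoint intervals the covariance is a second difference of \<open>x\<^sup>2\<^sup>H\<close>, which is a convex
  function because \<open>2 H \<ge> 1\<close>.\<close>

lemma fbm_increments_nonneg_correlated:
  assumes "0 \<le> u" "u \<le> v" "v \<le> p" "p \<le> q"
  shows "0 \<le> expectation (\<lambda>\<omega>. (X v \<omega> - X u \<omega>) * (X q \<omega> - X p \<omega>))"
proof -
  have "(p - v + (v - u)) powr (2 * H) - (p - v) powr (2 * H) \<le>
      (q - v + (v - u)) powr (2 * H) - (q - v) powr (2 * H)"
    using assms H by (intro powr_increment_mono) auto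
  then show ?thesis
    using assms by (subst fbm_increment_product(2)) auto
qed

text \<open>The two differences of powers in this covariance are increments of \<open>x\<^sup>2\<^sup>H\<close> over intervals of
  length \<open>v - u\<close> inside \<open>[0, t]\<close>, where the derivative is at most \<open>2 H t\<^sup>2\<^sup>H\<^sup>-\<^sup>1\<close>.\<close>

lemma fbm_increment_covariance_le:
  assumes "0 \<le> u" "u \<le> v" "v \<le> t"
  shows "expectation (\<lambda>\<omega>. (X v \<omega> - X u \<omega>) * (X t \<omega> - X 0 \<omega>)) \<le> 2 * H * t powr (2 * H - 1) * (v - u)"
proof -
  have "v powr (2 * H) - u powr (2 * H) \<le> 2 * H * t powr (2 * H - 1) * (v - u)"
    using assms H by (intro powr_diff_le) auto
  moreover have "(t - u) powr (2 * H) - (t - v) powr (2 * H) \<le>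
      2 * H * t powr (2 * H - 1) * ((t - u) - (t - v))"
    using assms H by (intro powr_diff_le) auto
  ultimately show ?thesis
    using assms by (subst fbm_increment_product(2)) auto
qed

text \<open>A discrete form of the bound \<open>\<integral>\<integral> b(r) b(s) \<bar>r - s\<bar>\<^sup>2\<^sup>H\<^sup>-\<^sup>2 dr ds \<le> \<integral> b(r)\<^sup>2 \<integral> \<bar>r - s\<bar>\<^sup>2\<^sup>H\<^sup>-\<^sup>2 ds dr\<close>.
  Since the covariances are nonnegative, the mixed products of coefficients may be replaced by
  means of squares; summing the covariances over one index then telescopes to the covariance of an
  increment with the value at the end point.\<close>

lemma fbm_sum_variance_le:
  fixes c :: "nat \<Rightarrow> real"
  assumes p: "mono p" "p 0 = 0" "p n = t"
  shows "expectation (\<lambda>\<omega>. (\<Sum>i<n. c i * (X (p (Suc i)) \<omega> - X (p i) \<omega>))\<^sup>2) \<le>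
    2 * H * t powr (2 * H - 1) * (\<Sum>i<n. (c i)\<^sup>2 * (p (Suc i) - p i))"
proof -
  define \<Delta> where "\<Delta> i \<omega> = X (p (Suc i)) \<omega> - X (p i) \<omega>" for i \<omega>
  define G where "G i j = expectation (\<lambda>\<omega>. \<Delta> i \<omega> * \<Delta> j \<omega>)" for i j
  have pos: "0 \<le> p i" for i
    using monoD [OF p(1), of 0 i] p(2) by simp
  have le: "p i \<le> p j" if "i \<le> j" for i j
    using monoD [OF p(1) that] .
  have int: "integrable M (\<lambda>\<omega>. \<Delta> i \<omega> * \<Delta> j \<omega>)" for i j
    unfolding \<Delta>_def using pos by (intro fbm_increment_product) auto
  have Gsym: "G i j = G j i" for i j
    by (simp add: G_def mult.commute)
  have "0 \<le> G i j" if "i \<le> j" for i j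
  proof (cases "i = j")
    case True
    then show ?thesis
      by (simp add: G_def)
  next
    case False
    then show ?thesis
      unfolding G_def \<Delta>_def using that pos le
      by (intro fbm_increments_nonneg_correlated) auto
  qed
  then have G0: "0 \<le> G i j" for i j
    using Gsym by (metis nle_le)
  have young: "c i * c j \<le> ((c i)\<^sup>2 + (c j)\<^sup>2) / 2" for i j
  proof -
    have "0 \<le> (c i - c j)\<^sup>2"
      by simp
    then show ?thesis
      by (simp only: power2_diff) simp
  qed
  have "expectation (\<lambda>\<omega>. (\<Sum>i<n. c i * \<Delta> i \<omega>)\<^sup>2) =
      expectation (\<lambda>\<omega>. \<Sum>i<n. \<Sum>j<n. c i * c j * (\<Delta> i \<omega> * \<Delta> j \<omega>))"
    by (intro Bochner_Integration.integral_cong refl)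
      (simp add: power2_eq_square sum_product ac_simps)
  also have "\<dots> = (\<Sum>i<n. \<Sum>j<n. c i * c j * G i j)"
    using int by (simp add: G_def)
  also have "\<dots> \<le> (\<Sum>i<n. \<Sum>j<n. ((c i)\<^sup>2 + (c j)\<^sup>2) / 2 * G i j)"
    using young G0 by (intro sum_mono mult_right_mono)
  also have "\<dots> = (\<Sum>i<n. \<Sum>j<n. (c i)\<^sup>2 / 2 * G i j) + (\<Sum>i<n. \<Sum>j<n. (c j)\<^sup>2 / 2 * G i j)"
    by (simp add: sum.distrib [symmetric] algebra_simps add_divide_distrib)
  \<comment> \<open>Both halves agree by symmetry of the covariance.\<close>
  also have "(\<Sum>i<n. \<Sum>j<n. (c j)\<^sup>2 / 2 * G i j) = (\<Sum>i<n. \<Sum>j<n. (c i)\<^sup>2 / 2 * G i j)"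
    by (subst sum.swap) (simp add: Gsym)
  also have "(\<Sum>i<n. \<Sum>j<n. (c i)\<^sup>2 / 2 * G i j) + (\<Sum>i<n. \<Sum>j<n. (c i)\<^sup>2 / 2 * G i j) =
      (\<Sum>i<n. (c i)\<^sup>2 * (\<Sum>j<n. G i j))"
    by (simp add: sum.distrib [symmetric] sum_distrib_left) (simp add: mult.commute)
  also have "\<dots> \<le> (\<Sum>i<n. (c i)\<^sup>2 * (2 * H * t powr (2 * H - 1) * (p (Suc i) - p i)))"
  proof (intro sum_mono mult_left_mono)
    fix i assume i: "i \<in> {..<n}"
    have "(\<Sum>j<n. G i j) = expectation (\<lambda>\<omega>. \<Sum>j<n. \<Delta> i \<omega> * \<Delta> j \<omega>)"
      using int by (simp add: G_def)
    also have "\<dots> = expectation (\<lambda>\<omega>. (X (p (Suc i)) \<omega> - X (p i) \<omega>) * (X t \<omega> - X 0 \<omega>))"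
      using sum_lessThan_telescope [of "\<lambda>j. X (p j) _" n]
      by (simp add: sum_distrib_left [symmetric] \<Delta>_def p)
    also have "\<dots> \<le> 2 * H * t powr (2 * H - 1) * (p (Suc i) - p i)"
      using i pos le [of i "Suc i"] le [of "Suc i" n] p by (intro fbm_increment_covariance_le) auto
    finally show "(\<Sum>j<n. G i j) \<le> 2 * H * t powr (2 * H - 1) * (p (Suc i) - p i)" .
  qed simp
  also have "\<dots> = 2 * H * t powr (2 * H - 1) * (\<Sum>i<n. (c i)\<^sup>2 * (p (Suc i) - p i))"
    by (simp add: sum_distrib_left ac_simps)
  finally show ?thesis
    by (simp add: \<Delta>_def)
qed

text \<open>A sum of weighted increments is a linear combination of values of the process once the
  coefficients belonging to the same time are collected; times may coincide.\<close>

lemma fbm_sum_gaussian: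
  fixes c :: "nat \<Rightarrow> real"
  assumes p: "\<And>i. 0 \<le> p i"
  shows "gaussian_rv M (\<lambda>\<omega>. \<Sum>i<n. c i * (X (p (Suc i)) \<omega> - X (p i) \<omega>))"
proof -
  define J where "J = p ` {..n}"
  define w where "w s = (\<Sum>i | i \<in> {..<n} \<and> p (Suc i) = s. c i) - (\<Sum>i | i \<in> {..<n} \<and> p i = s. c i)" for s
  have collect: "(\<Sum>s\<in>J. (\<Sum>i | i \<in> {..<n} \<and> f i = s. c i) * X s \<omega>) = (\<Sum>i<n. c i * X (f i) \<omega>)"
    if "f ` {..<n} \<subseteq> J" for f :: "nat \<Rightarrow> real" and \<omega>
  proof -
    have "(\<Sum>s\<in>J. (\<Sum>i | i \<in> {..<n} \<and> f i = s. c i) * X s \<omega>) =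
        (\<Sum>s\<in>J. \<Sum>i | i \<in> {..<n} \<and> f i = s. c i * X (f i) \<omega>)"
      by (simp add: sum_distrib_right)
    also have "\<dots> = (\<Sum>i<n. c i * X (f i) \<omega>)"
      using that by (intro sum.group) (auto simp: J_def)
    finally show ?thesis .
  qed
  have "gaussian_process M X"
    using fbm by (simp add: fractional_brownian_motion_def)
  then have "gaussian_rv M (\<lambda>\<omega>. \<Sum>s\<in>J. w s * X s \<omega>)"
    using p unfolding gaussian_process_def by (simp add: J_def image_subset_iff)
  moreover have "(\<Sum>s\<in>J. w s * X s \<omega>) = (\<Sum>i<n. c i * (X (p (Suc i)) \<omega> - X (p i) \<omega>))" for \<omega>
    using collect [of "\<lambda>i. p (Suc i)" \<omega>] collect [of p \<omega>]
    by (simp add: w_def J_def left_diff_distrib right_diff_distrib sum_subtractf image_subset_iff)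
  ultimately show ?thesis
    by simp
qed

lemma fbm_sum_exp_le:
  fixes c :: "nat \<Rightarrow> real"
  assumes p: "mono p" "p 0 = 0" "p n = t"
  shows "(\<integral>\<^sup>+\<omega>. ennreal (exp (\<theta> * (\<Sum>i<n. c i * (X (p (Suc i)) \<omega> - X (p i) \<omega>)))) \<partial>M) \<le>
    ennreal (exp (\<theta>\<^sup>2 * H * t powr (2 * H - 1) * (\<Sum>i<n. (c i)\<^sup>2 * (p (Suc i) - p i))))"
proof -
  let ?S = "\<lambda>\<omega>. \<Sum>i<n. c i * (X (p (Suc i)) \<omega> - X (p i) \<omega>)"
  have pos: "0 \<le> p i" for i
    using monoD [OF p(1), of 0 i] p(2) by simp
  have "expectation (X (p i)) = 0" for i
    using fbm pos by (simp add: fractional_brownian_motion_def)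
  then have "expectation ?S = 0"
    using pos by (simp add: fbm_integrable)
  with pos have "(\<integral>\<^sup>+\<omega>. ennreal (exp (\<theta> * ?S \<omega>)) \<partial>M) =
      ennreal (exp (\<theta>\<^sup>2 / 2 * expectation (\<lambda>\<omega>. (?S \<omega>)\<^sup>2)))"
    by (intro nn_integral_exp_centered_gaussian_rv fbm_sum_gaussian)
  also have "\<dots> \<le> ennreal (exp (\<theta>\<^sup>2 / 2 *
      (2 * H * t powr (2 * H - 1) * (\<Sum>i<n. (c i)\<^sup>2 * (p (Suc i) - p i)))))"
    by (intro ennreal_leI, subst exp_le_cancel_iff,
        intro mult_left_mono fbm_sum_variance_le p) simp
  finally show ?thesis
    by (simp add: ac_simps)
qed

lemma fbm_stieltjes_exp_le:
  assumes b: "continuous_on {0..t} b" and t: "0 < t"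
    and J: "AE \<omega> in M. has_rs_integral b (\<lambda>s. X s \<omega>) 0 t (J \<omega>)"
  shows "(\<integral>\<^sup>+\<omega>. ennreal (exp (\<theta> * J \<omega>)) \<partial>M) \<le>
    ennreal (exp (\<theta>\<^sup>2 * H * t powr (2 * H - 1) * sq_int b t))"
proof (rule nn_integral_exp_limit_le)
  define p where "p n i = t * real i / real (Suc n)" for n i :: nat
  have p: "mono (p n)" "p n 0 = 0" "p n (Suc n) = t" "0 \<le> p n i" for n i
    using t by (auto simp: p_def mono_def intro!: divide_right_mono mult_left_mono)
  have step: "p n (Suc i) - p n i = t / Suc n" for n i
    unfolding p_def diff_divide_distrib [symmetric] by (simp add: algebra_simps)
  let ?S = "\<lambda>n \<omega>. \<Sum>i<Suc n. b (p n i) * (X (p n (Suc i)) \<omega> - X (p n i) \<omega>)"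
  show "(\<lambda>\<omega>. \<theta> * ?S n \<omega>) \<in> borel_measurable M" for n
    using p by (intro borel_measurable_times borel_measurable_sum borel_measurable_diff
        fbm_measurable borel_measurable_const)
  show "AE \<omega> in M. (\<lambda>n. \<theta> * ?S n \<omega>) \<longlonglongrightarrow> \<theta> * J \<omega>"
    using J
  proof eventually_elim
    case (elim \<omega>)
    show ?case
      unfolding p_def by (intro tendsto_mult_left has_rs_integral_left_sums elim t)
  qed
  show "(\<integral>\<^sup>+\<omega>. ennreal (exp (\<theta> * ?S n \<omega>)) \<partial>M) \<le> ennreal (exp (\<theta>\<^sup>2 * H * t powr (2 * H - 1) *
      (\<Sum>i<Suc n. (b (p n i))\<^sup>2 * (p n (Suc i) - p n i))))" for n
    by (intro fbm_sum_exp_le p)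
  have "continuous_on {0..t} (\<lambda>s. (b s)\<^sup>2)"
    using b by (intro continuous_intros)
  from left_riemann_sums_tendsto [OF this t]
  show "(\<lambda>n. \<theta>\<^sup>2 * H * t powr (2 * H - 1) *
      (\<Sum>i<Suc n. (b (p n i))\<^sup>2 * (p n (Suc i) - p n i))) \<longlonglongrightarrow>
      \<theta>\<^sup>2 * H * t powr (2 * H - 1) * sq_int b t"
    unfolding step sq_int_def by (intro tendsto_mult_left) (simp only: p_def)
qed

end

end

section \<open>Ito integrals of deterministic functions\<close>

text \<open>The length of the intersection of the intervals from \<open>u\<close> to \<open>v\<close> and from \<open>p\<close> to \<open>q\<close>.\<close>

definition overlap :: "real \<Rightarrow> real \<Rightarrow> real \<Rightarrow> real \<Rightarrow> real" where
  "overlap u v p q = max 0 (min v q - max u p)"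

context prob_space
begin

context
  fixes F :: "real \<Rightarrow> 'a measure" and B :: "real \<Rightarrow> 'a \<Rightarrow> real"
  assumes filt: "filtered_prob_space M F" and bm: "brownian_motion M F B"
begin

lemma filtration_measurable_mono:
  assumes "f \<in> F s \<rightarrow>\<^sub>M A" "0 \<le> s" "s \<le> t"
  shows "f \<in> F t \<rightarrow>\<^sub>M A"
  using filt assms by (auto simp: filtered_prob_space_def intro: measurable_from_subalg)

lemma filtration_measurable:
  assumes "f \<in> F s \<rightarrow>\<^sub>M A" "0 \<le> s"
  shows "f \<in> M \<rightarrow>\<^sub>M A"
  using filt assms by (auto simp: filtered_prob_space_def intro: measurable_from_subalg)

lemma brownian_measurable:
  assumes "0 \<le> s" "s \<le> t"
  shows "B s \<in> borel_measurable (F t)"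
proof -
  have "B s \<in> borel_measurable (F s)"
    using bm assms by (simp add: brownian_motion_def adapted_process_def)
  then show ?thesis
    using assms by (rule filtration_measurable_mono)
qed

lemma brownian_measurable_M: "0 \<le> s \<Longrightarrow> B s \<in> borel_measurable M"
  using brownian_measurable [of s s] filtration_measurable by auto

lemma brownian_increment_indep:
  assumes s: "0 \<le> s" "s < t" and Z: "Z \<in> borel_measurable (F s)"
  shows "indep_var borel Z borel (\<lambda>\<omega>. B t \<omega> - B s \<omega>)"
proof -
  let ?\<Delta> = "\<lambda>\<omega>. B t \<omega> - B s \<omega>"
  have rv: "Z \<in> borel_measurable M" "?\<Delta> \<in> borel_measurable M"
    using s brownian_measurable_M filtration_measurable [OF Z] by auto
  have sp: "space (F s) = space M"
    using filt s by (auto simp: filtered_prob_space_def subalgebra_def)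
  have ind: "indep_set (sets (F s)) (sets (vimage_algebra (space M) ?\<Delta> borel))"
    using bm s by (auto simp: brownian_motion_def)
  have "{Z -` A \<inter> space M | A. A \<in> sets borel} \<subseteq> sets (F s)"
    using measurable_sets [OF Z] by (auto simp: sp)
  then have sub: "sigma_sets (space M) {Z -` A \<inter> space M | A. A \<in> sets borel} \<subseteq> sets (F s)"
    using sets.sigma_sets_subset [of _ "F s"] by (simp add: sp)
  have "indep_set (sigma_sets (space M) {Z -` A \<inter> space M | A. A \<in> sets borel})
      (sigma_sets (space M) {?\<Delta> -` A \<inter> space M | A. A \<in> sets borel})"
    unfolding indep_set_def
    by (rule indep_sets_mono_sets [OF ind [unfolded indep_set_def]])
      (use sub in \<open>auto simp: sets_vimage_algebra split: bool.split\<close>)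
  then show ?thesis
    using rv by (simp add: indep_var_eq)
qed

lemma brownian_increment_moments:
  assumes s: "0 \<le> s" "s \<le> t"
  shows "integrable M (\<lambda>\<omega>. B t \<omega> - B s \<omega>)" "expectation (\<lambda>\<omega>. B t \<omega> - B s \<omega>) = 0"
    "integrable M (\<lambda>\<omega>. (B t \<omega> - B s \<omega>)\<^sup>2)" "expectation (\<lambda>\<omega>. (B t \<omega> - B s \<omega>)\<^sup>2) = t - s"
    "(\<integral>\<^sup>+\<omega>. ennreal (exp (\<theta> * (B t \<omega> - B s \<omega>))) \<partial>M) = ennreal (exp (\<theta>\<^sup>2 / 2 * (t - s)))"
proof -
  have "integrable M (\<lambda>\<omega>. B t \<omega> - B s \<omega>) \<and> expectation (\<lambda>\<omega>. B t \<omega> - B s \<omega>) = 0 \<and>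
    integrable M (\<lambda>\<omega>. (B t \<omega> - B s \<omega>)\<^sup>2) \<and> expectation (\<lambda>\<omega>. (B t \<omega> - B s \<omega>)\<^sup>2) = t - s \<and>
    (\<integral>\<^sup>+\<omega>. ennreal (exp (\<theta> * (B t \<omega> - B s \<omega>))) \<partial>M) = ennreal (exp (\<theta>\<^sup>2 / 2 * (t - s)))"
  proof (cases "s = t")
    case True
    then show ?thesis
      by (simp add: emeasure_space_1)
  next
    case False
    then have "s < t"
      using s by simp
    then have *: "distributed M lborel (\<lambda>\<omega>. B t \<omega> - B s \<omega>)
        (\<lambda>x. ennreal (normal_density 0 (sqrt (t - s)) x))" and "0 < sqrt (t - s)"
      using bm s by (auto simp: brownian_motion_def)
    then show ?thesis
      using distributed_normal_square [OF *] nn_integral_exp_distributed_normal [OF *, of \<theta>] \<open>s < t\<close>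
      by simp
  qed
  then show "integrable M (\<lambda>\<omega>. B t \<omega> - B s \<omega>)" "expectation (\<lambda>\<omega>. B t \<omega> - B s \<omega>) = 0"
    "integrable M (\<lambda>\<omega>. (B t \<omega> - B s \<omega>)\<^sup>2)" "expectation (\<lambda>\<omega>. (B t \<omega> - B s \<omega>)\<^sup>2) = t - s"
    "(\<integral>\<^sup>+\<omega>. ennreal (exp (\<theta> * (B t \<omega> - B s \<omega>))) \<partial>M) = ennreal (exp (\<theta>\<^sup>2 / 2 * (t - s)))"
    by blast+
qed

lemma brownian_increment_after:
  assumes s: "0 \<le> s" "s \<le> t" and Z: "Z \<in> borel_measurable (F s)" "integrable M Z"
  shows "integrable M (\<lambda>\<omega>. Z \<omega> * (B t \<omega> - B s \<omega>))"
    and "expectation (\<lambda>\<omega>. Z \<omega> * (B t \<omega> - B s \<omega>)) = 0"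
    and "integrable M (\<lambda>\<omega>. Z \<omega> * (B t \<omega> - B s \<omega>)\<^sup>2)"
    and "expectation (\<lambda>\<omega>. Z \<omega> * (B t \<omega> - B s \<omega>)\<^sup>2) = expectation Z * (t - s)"
proof -
  note m = brownian_increment_moments [OF s]
  have "integrable M (\<lambda>\<omega>. Z \<omega> * (B t \<omega> - B s \<omega>)) \<and>
    expectation (\<lambda>\<omega>. Z \<omega> * (B t \<omega> - B s \<omega>)) = 0 \<and>
    integrable M (\<lambda>\<omega>. Z \<omega> * (B t \<omega> - B s \<omega>)\<^sup>2) \<and>
    expectation (\<lambda>\<omega>. Z \<omega> * (B t \<omega> - B s \<omega>)\<^sup>2) = expectation Z * (t - s)"
  proof (cases "s = t")
    case False
    then have ind: "indep_var borel Z borel (\<lambda>\<omega>. B t \<omega> - B s \<omega>)"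
      using s Z by (intro brownian_increment_indep) auto
    have "indep_var borel ((\<lambda>x. x) \<circ> Z) borel ((\<lambda>x. x\<^sup>2) \<circ> (\<lambda>\<omega>. B t \<omega> - B s \<omega>))"
      by (rule indep_var_compose [OF ind]) auto
    then have ind2: "indep_var borel Z borel (\<lambda>\<omega>. (B t \<omega> - B s \<omega>)\<^sup>2)"
      by (simp add: o_def)
    show ?thesis
      using indep_var_integrable [OF ind Z(2) m(1)] indep_var_lebesgue_integral [OF ind Z(2) m(1)]
        indep_var_integrable [OF ind2 Z(2) m(3)] indep_var_lebesgue_integral [OF ind2 Z(2) m(3)]
        m(2,4) by simp
  qed simp
  then show "integrable M (\<lambda>\<omega>. Z \<omega> * (B t \<omega> - B s \<omega>))"
    and "expectation (\<lambda>\<omega>. Z \<omega> * (B t \<omega> - B s \<omega>)) = 0"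
    and "integrable M (\<lambda>\<omega>. Z \<omega> * (B t \<omega> - B s \<omega>)\<^sup>2)"
    and "expectation (\<lambda>\<omega>. Z \<omega> * (B t \<omega> - B s \<omega>)\<^sup>2) = expectation Z * (t - s)"
    by auto
qed

text \<open>By induction: the last increment is independent of the preceding sum.\<close>

lemma brownian_sum_exp:
  fixes c :: "nat \<Rightarrow> real"
  assumes p: "mono p" "0 \<le> p 0"
  shows "(\<integral>\<^sup>+\<omega>. ennreal (exp (\<theta> * (\<Sum>i<n. c i * (B (p (Suc i)) \<omega> - B (p i) \<omega>)))) \<partial>M) =
    ennreal (exp (\<theta>\<^sup>2 / 2 * (\<Sum>i<n. (c i)\<^sup>2 * (p (Suc i) - p i))))"
proof (induction n)
  case 0
  then show ?case
    by (simp add: emeasure_space_1)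
next
  case (Suc n)
  have pos: "0 \<le> p i" for i
    using monoD [OF p(1), of 0 i] p(2) by simp
  have le: "p i \<le> p j" if "i \<le> j" for i j
    using monoD [OF p(1) that] .
  let ?S = "\<lambda>\<omega>. \<Sum>i<n. c i * (B (p (Suc i)) \<omega> - B (p i) \<omega>)"
  let ?\<Delta> = "\<lambda>\<omega>. B (p (Suc n)) \<omega> - B (p n) \<omega>"
  have S: "?S \<in> borel_measurable (F (p n))"
    using pos le by (intro borel_measurable_sum borel_measurable_times borel_measurable_diff
        borel_measurable_const brownian_measurable) auto
  have "(\<integral>\<^sup>+\<omega>. ennreal (exp (\<theta> * ?S \<omega>)) * ennreal (exp (\<theta> * c n * ?\<Delta> \<omega>)) \<partial>M) =
      (\<integral>\<^sup>+\<omega>. ennreal (exp (\<theta> * ?S \<omega>)) \<partial>M) * (\<integral>\<^sup>+\<omega>. ennreal (exp (\<theta> * c n * ?\<Delta> \<omega>)) \<partial>M)"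
  proof (cases "p n = p (Suc n)")
    case True
    then show ?thesis
      by (simp add: emeasure_space_1)
  next
    case False
    then have "indep_var borel ?S borel ?\<Delta>"
      using S pos le [of n "Suc n"] by (intro brownian_increment_indep) auto
    from indep_var_compose [OF this, of "\<lambda>x. ennreal (exp (\<theta> * x))" borel
        "\<lambda>x. ennreal (exp (\<theta> * c n * x))" borel]
    have "indep_var borel (\<lambda>\<omega>. ennreal (exp (\<theta> * ?S \<omega>)))
        borel (\<lambda>\<omega>. ennreal (exp (\<theta> * c n * ?\<Delta> \<omega>)))"
      by (simp add: o_def)
    then show ?thesis
      by (rule indep_var_nn_integral_mult)
  qed
  also have "\<dots> = ennreal (exp (\<theta>\<^sup>2 / 2 * (\<Sum>i<n. (c i)\<^sup>2 * (p (Suc i) - p i)))) *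
      ennreal (exp ((\<theta> * c n)\<^sup>2 / 2 * (p (Suc n) - p n)))"
    using Suc.IH brownian_increment_moments(5) [OF pos le [of n "Suc n"], of "\<theta> * c n"] by simp
  also have "\<dots> = ennreal (exp (\<theta>\<^sup>2 / 2 * (\<Sum>i<Suc n. (c i)\<^sup>2 * (p (Suc i) - p i))))"
  proof -
    have "\<theta>\<^sup>2 / 2 * (\<Sum>i<n. (c i)\<^sup>2 * (p (Suc i) - p i)) + (\<theta> * c n)\<^sup>2 / 2 * (p (Suc n) - p n) =
        \<theta>\<^sup>2 / 2 * (\<Sum>i<Suc n. (c i)\<^sup>2 * (p (Suc i) - p i))"
      by (simp add: distrib_left power_mult_distrib)
    then show ?thesis
      by (simp only: ennreal_mult' [symmetric] exp_add [symmetric] exp_ge_zero)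
  qed
  also have "(\<integral>\<^sup>+\<omega>. ennreal (exp (\<theta> * ?S \<omega>)) * ennreal (exp (\<theta> * c n * ?\<Delta> \<omega>)) \<partial>M) =
      (\<integral>\<^sup>+\<omega>. ennreal (exp (\<theta> * (\<Sum>i<Suc n. c i * (B (p (Suc i)) \<omega> - B (p i) \<omega>)))) \<partial>M)"
  proof -
    have "\<theta> * ?S \<omega> + \<theta> * c n * ?\<Delta> \<omega> =
        \<theta> * (\<Sum>i<Suc n. c i * (B (p (Suc i)) \<omega> - B (p i) \<omega>))" for \<omega>
      by (simp add: distrib_left)
    then show ?thesis
      by (simp only: ennreal_mult' [symmetric] exp_add [symmetric] exp_ge_zero)
  qed
  finally show ?case .
qed

lemma weighted_increment_square_integrable:
  assumes "0 \<le> u" "u \<le> v" and \<xi>: "\<xi> \<in> borel_measurable (F u)" "bounded (\<xi> ` space M)"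
  shows "integrable M (\<lambda>\<omega>. (\<xi> \<omega> * (B v \<omega> - B u \<omega>))\<^sup>2)"
proof -
  have "integrable M (\<lambda>\<omega>. (\<xi> \<omega> * \<xi> \<omega>) * (B v \<omega> - B u \<omega>)\<^sup>2)"
    using assms filtration_measurable [OF \<xi>(1)]
    by (intro brownian_increment_after integrable_bounded bounded_image_mult
        borel_measurable_times) auto
  then show ?thesis
    by (simp add: power_mult_distrib power2_eq_square ac_simps)
qed

text \<open>If the intervals are disjoint, the later increment is independent of everything else and
  has mean \<open>0\<close>. Otherwise the part of the first increment before \<open>p\<close> and the part of the
  longer increment after \<open>min v q\<close> drop out for the same reason, and the square of the increment over
  the intersection remains.\<close>

lemma weighted_increments_product_ordered:
  assumes u: "0 \<le> u" "u \<le> v" and p: "u \<le> p" "p \<le> q"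
    and \<xi>: "\<xi> \<in> borel_measurable (F u)" "bounded (\<xi> ` space M)"
    and \<eta>: "\<eta> \<in> borel_measurable (F p)" "bounded (\<eta> ` space M)"
  shows "expectation (\<lambda>\<omega>. (\<xi> \<omega> * (B v \<omega> - B u \<omega>)) * (\<eta> \<omega> * (B q \<omega> - B p \<omega>))) =
      expectation (\<lambda>\<omega>. \<xi> \<omega> * \<eta> \<omega>) * max 0 (min v q - p)"
proof -
  let ?\<zeta> = "\<lambda>\<omega>. \<xi> \<omega> * \<eta> \<omega>"
  have p0: "0 \<le> p"
    using u p by simp
  have \<zeta>: "?\<zeta> \<in> borel_measurable (F p)" "bounded (?\<zeta> ` space M)"
    using \<eta> \<xi> filtration_measurable_mono [OF \<xi>(1) u(1) p(1)] bounded_image_mult by auto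
  have \<zeta>_int: "integrable M (\<lambda>\<omega>. ?\<zeta> \<omega> * (B r \<omega> - B s \<omega>))" if "0 \<le> s" "s \<le> r" for r s
    using that \<zeta> p0 filtration_measurable
    by (intro integrable_bounded_mult brownian_increment_moments) auto
  have \<zeta>_meas: "(\<lambda>\<omega>. ?\<zeta> \<omega> * (B r \<omega> - B s \<omega>)) \<in> borel_measurable (F w)"
    if "0 \<le> s" "s \<le> w" "0 \<le> r" "r \<le> w" "p \<le> w" for r s w
    using that p0
    by (intro borel_measurable_times [OF filtration_measurable_mono [OF \<zeta>(1)]]
        borel_measurable_diff brownian_measurable) auto
  show ?thesis
  proof (cases "v \<le> p")
    case True
    have "expectation (\<lambda>\<omega>. (?\<zeta> \<omega> * (B v \<omega> - B u \<omega>)) * (B q \<omega> - B p \<omega>)) = 0"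
      using u p p0 True by (intro brownian_increment_after \<zeta>_int \<zeta>_meas) auto
    then show ?thesis
      using True by (simp add: ac_simps)
  next
    case False
    \<comment> \<open>From \<open>p\<close> to \<open>m\<close> both increments run; between \<open>m\<close> and \<open>w\<close> only one of them does.\<close>
    define m where "m = min v q"
    define w where "w = max v q"
    have m: "p \<le> m" "m \<le> w" "0 \<le> m"
      using False p p0 by (auto simp: m_def w_def)
    have 1: "integrable M (\<lambda>\<omega>. (?\<zeta> \<omega> * (B p \<omega> - B u \<omega>)) * (B q \<omega> - B p \<omega>))"
      "expectation (\<lambda>\<omega>. (?\<zeta> \<omega> * (B p \<omega> - B u \<omega>)) * (B q \<omega> - B p \<omega>)) = 0"
      using u p p0 by (auto intro!: brownian_increment_after \<zeta>_int \<zeta>_meas)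
    have 2: "integrable M (\<lambda>\<omega>. (?\<zeta> \<omega> * (B m \<omega> - B p \<omega>)) * (B w \<omega> - B m \<omega>))"
      "expectation (\<lambda>\<omega>. (?\<zeta> \<omega> * (B m \<omega> - B p \<omega>)) * (B w \<omega> - B m \<omega>)) = 0"
      using m p0 by (auto intro!: brownian_increment_after \<zeta>_int \<zeta>_meas)
    have \<zeta>i: "integrable M ?\<zeta>"
      using \<zeta> p0 filtration_measurable by (intro integrable_bounded) auto
    have 3: "integrable M (\<lambda>\<omega>. ?\<zeta> \<omega> * (B m \<omega> - B p \<omega>)\<^sup>2)"
      "expectation (\<lambda>\<omega>. ?\<zeta> \<omega> * (B m \<omega> - B p \<omega>)\<^sup>2) = expectation ?\<zeta> * (m - p)"
      using brownian_increment_after(3,4) [OF p0 m(1) \<zeta>(1) \<zeta>i] by auto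
    have "(\<xi> \<omega> * (B v \<omega> - B u \<omega>)) * (\<eta> \<omega> * (B q \<omega> - B p \<omega>)) =
        (?\<zeta> \<omega> * (B p \<omega> - B u \<omega>)) * (B q \<omega> - B p \<omega>) +
        ((?\<zeta> \<omega> * (B m \<omega> - B p \<omega>)) * (B w \<omega> - B m \<omega>) + ?\<zeta> \<omega> * (B m \<omega> - B p \<omega>)\<^sup>2)" for \<omega>
      by (cases "v \<le> q") (simp_all add: m_def w_def min_def max_def algebra_simps power2_eq_square)
    then show ?thesis
      using 1 2 3 m by (simp add: m_def)
  qed
qed

lemma weighted_increments_product:
  assumes u: "0 \<le> u" "u \<le> v" and p: "0 \<le> p" "p \<le> q"
    and \<xi>: "\<xi> \<in> borel_measurable (F u)" "bounded (\<xi> ` space M)"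
    and \<eta>: "\<eta> \<in> borel_measurable (F p)" "bounded (\<eta> ` space M)"
  shows "integrable M (\<lambda>\<omega>. (\<xi> \<omega> * (B v \<omega> - B u \<omega>)) * (\<eta> \<omega> * (B q \<omega> - B p \<omega>)))"
    and "expectation (\<lambda>\<omega>. (\<xi> \<omega> * (B v \<omega> - B u \<omega>)) * (\<eta> \<omega> * (B q \<omega> - B p \<omega>))) =
      expectation (\<lambda>\<omega>. \<xi> \<omega> * \<eta> \<omega>) * overlap u v p q"
proof -
  show "integrable M (\<lambda>\<omega>. (\<xi> \<omega> * (B v \<omega> - B u \<omega>)) * (\<eta> \<omega> * (B q \<omega> - B p \<omega>)))"
    using assms filtration_measurable
    by (intro integrable_product_of_squares weighted_increment_square_integrable
        borel_measurable_times borel_measurable_diff brownian_measurable_M) auto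
  show "expectation (\<lambda>\<omega>. (\<xi> \<omega> * (B v \<omega> - B u \<omega>)) * (\<eta> \<omega> * (B q \<omega> - B p \<omega>))) =
      expectation (\<lambda>\<omega>. \<xi> \<omega> * \<eta> \<omega>) * overlap u v p q"
  proof (cases "u \<le> p")
    case True
    then show ?thesis
      using weighted_increments_product_ordered [OF u True p(2) \<xi> \<eta>]
      by (simp add: overlap_def max_def)
  next
    case False
    then have "p \<le> u"
      by simp
    from weighted_increments_product_ordered [OF p this u(2) \<eta> \<xi>] show ?thesis
      using False by (simp add: overlap_def max_def min.commute mult.commute)
  qed
qed

text \<open>The intervals may overlap and need not form a grid. The difference of two simple integrals over
  unrelated grids is therefore covered without a common refinement.\<close>

lemma ito_isometry_family:
  fixes u v :: "'i \<Rightarrow> real" and \<xi> :: "'i \<Rightarrow> 'a \<Rightarrow> real"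
  assumes I: "finite I" and uv: "\<And>i. i \<in> I \<Longrightarrow> 0 \<le> u i \<and> u i \<le> v i \<and> v i \<le> t"
    and \<xi>: "\<And>i. i \<in> I \<Longrightarrow> \<xi> i \<in> borel_measurable (F (u i))"
      "\<And>i. i \<in> I \<Longrightarrow> bounded (\<xi> i ` space M)"
  shows "(\<integral>\<^sup>+\<omega>. ennreal ((\<Sum>i\<in>I. \<xi> i \<omega> * (B (v i) \<omega> - B (u i) \<omega>))\<^sup>2) \<partial>M) =
    (\<integral>\<^sup>+\<omega>. (\<integral>\<^sup>+s. ennreal ((\<Sum>i\<in>I. \<xi> i \<omega> * indicator {u i<..v i} s)\<^sup>2) \<partial>leb {0..t}) \<partial>M)"
proof -
  define ov where "ov i j = overlap (u i) (v i) (u j) (v j)" for i j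
  let ?\<Delta> = "\<lambda>i \<omega>. B (v i) \<omega> - B (u i) \<omega>"
  have prod: "integrable M (\<lambda>\<omega>. (\<xi> i \<omega> * ?\<Delta> i \<omega>) * (\<xi> j \<omega> * ?\<Delta> j \<omega>))"
    "expectation (\<lambda>\<omega>. (\<xi> i \<omega> * ?\<Delta> i \<omega>) * (\<xi> j \<omega> * ?\<Delta> j \<omega>)) = expectation (\<lambda>\<omega>. \<xi> i \<omega> * \<xi> j \<omega>) * ov i j"
    if "i \<in> I" "j \<in> I" for i j
    using weighted_increments_product [of "u i" "v i" "u j" "v j" "\<xi> i" "\<xi> j"] uv \<xi> that
    by (auto simp: ov_def)
  have \<xi>\<xi>: "integrable M (\<lambda>\<omega>. \<xi> i \<omega> * \<xi> j \<omega>)" if "i \<in> I" "j \<in> I" for i j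
    using uv \<xi> that filtration_measurable
    by (intro integrable_bounded bounded_image_mult borel_measurable_times) blast+
  have square: "(\<Sum>i\<in>I. f i)\<^sup>2 = (\<Sum>i\<in>I. \<Sum>j\<in>I. f i * f j)" for f :: "'i \<Rightarrow> real"
    by (simp add: power2_eq_square sum_product)
  have "integrable M (\<lambda>\<omega>. (\<Sum>i\<in>I. \<xi> i \<omega> * ?\<Delta> i \<omega>)\<^sup>2)"
    unfolding square using prod by (intro Bochner_Integration.integrable_sum)
  then have "(\<integral>\<^sup>+\<omega>. ennreal ((\<Sum>i\<in>I. \<xi> i \<omega> * ?\<Delta> i \<omega>)\<^sup>2) \<partial>M) =
      ennreal (expectation (\<lambda>\<omega>. (\<Sum>i\<in>I. \<xi> i \<omega> * ?\<Delta> i \<omega>)\<^sup>2))"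
    by (intro nn_integral_eq_integral) auto
  also have "expectation (\<lambda>\<omega>. (\<Sum>i\<in>I. \<xi> i \<omega> * ?\<Delta> i \<omega>)\<^sup>2) =
      (\<Sum>i\<in>I. \<Sum>j\<in>I. expectation (\<lambda>\<omega>. \<xi> i \<omega> * \<xi> j \<omega>) * ov i j)"
    unfolding square using prod by (simp add: Bochner_Integration.integral_sum
        Bochner_Integration.integrable_sum)
  also have "\<dots> = expectation (\<lambda>\<omega>. \<Sum>i\<in>I. \<Sum>j\<in>I. \<xi> i \<omega> * \<xi> j \<omega> * ov i j)"
    using \<xi>\<xi> by (simp add: Bochner_Integration.integral_sum Bochner_Integration.integrable_sum)
  finally have left: "(\<integral>\<^sup>+\<omega>. ennreal ((\<Sum>i\<in>I. \<xi> i \<omega> * ?\<Delta> i \<omega>)\<^sup>2) \<partial>M) =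
      ennreal (expectation (\<lambda>\<omega>. \<Sum>i\<in>I. \<Sum>j\<in>I. \<xi> i \<omega> * \<xi> j \<omega> * ov i j))" .
  have ind: "has_bochner_integral (leb {0..t})
      (\<lambda>s. indicator {u i<..v i} s * indicator {u j<..v j} s) (ov i j)"
    if "i \<in> I" "j \<in> I" for i j
  proof -
    let ?A = "{max (u i) (u j)<..min (v i) (v j)}"
    have A: "?A \<subseteq> {0..t}"
      using uv that by force
    have "has_bochner_integral (leb {0..t}) (indicator ?A) (measure (leb {0..t}) ?A)"
    proof (rule has_bochner_integral_real_indicator)
      show "?A \<in> sets (leb {0..t})"
        using A by (simp add: sets_restrict_space_iff)
      show "emeasure (leb {0..t}) ?A < \<infinity>"
        unfolding emeasure_restrict_space [OF _ A, of lborel, simplified]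
        by (rule emeasure_bounded_finite) simp
    qed
    moreover have "measure (leb {0..t}) ?A = ov i j"
      unfolding measure_restrict_space [OF _ A, of lborel, simplified] ov_def overlap_def
    proof (cases "max (u i) (u j) \<le> min (v i) (v j)")
      case True
      then show "measure lborel ?A = max 0 (min (v i) (v j) - max (u i) (u j))"
        unfolding measure_lborel_Ioc [OF True] by (simp only: max_absorb2 diff_ge_0_iff_ge)
    next
      case False
      then have "?A = {}"
        by auto
      with False show "measure lborel ?A = max 0 (min (v i) (v j) - max (u i) (u j))"
        by (simp only: measure_empty)
    qed
    moreover have "(\<lambda>s. indicator {u i<..v i} s * indicator {u j<..v j} s :: real) = indicator ?A"
      by (auto simp: fun_eq_iff indicator_def)
    ultimately show ?thesis
      by simp
  qed
  \<comment> \<open>For a fixed outcome, the squared path integrates to the same double sum that the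
    increments produce in expectation.\<close>
  have inner: "(\<integral>\<^sup>+s. ennreal ((\<Sum>i\<in>I. \<xi> i \<omega> * indicator {u i<..v i} s)\<^sup>2) \<partial>leb {0..t}) =
      ennreal (\<Sum>i\<in>I. \<Sum>j\<in>I. \<xi> i \<omega> * \<xi> j \<omega> * ov i j)"
    and inner_nonneg: "0 \<le> (\<Sum>i\<in>I. \<Sum>j\<in>I. \<xi> i \<omega> * \<xi> j \<omega> * ov i j)" for \<omega>
  proof -
    have "has_bochner_integral (leb {0..t})
        (\<lambda>s. \<Sum>i\<in>I. \<Sum>j\<in>I. \<xi> i \<omega> * \<xi> j \<omega> * (indicator {u i<..v i} s * indicator {u j<..v j} s))
        (\<Sum>i\<in>I. \<Sum>j\<in>I. \<xi> i \<omega> * \<xi> j \<omega> * ov i j)"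
      by (intro has_bochner_integral_sum has_bochner_integral_mult_right ind)
    also have "(\<lambda>s. \<Sum>i\<in>I. \<Sum>j\<in>I. \<xi> i \<omega> * \<xi> j \<omega> *
        (indicator {u i<..v i} s * indicator {u j<..v j} s)) =
        (\<lambda>s. (\<Sum>i\<in>I. \<xi> i \<omega> * indicator {u i<..v i} s)\<^sup>2)"
      unfolding square by (simp add: ac_simps)
    finally have hb: "has_bochner_integral (leb {0..t})
        (\<lambda>s. (\<Sum>i\<in>I. \<xi> i \<omega> * indicator {u i<..v i} s)\<^sup>2)
        (\<Sum>i\<in>I. \<Sum>j\<in>I. \<xi> i \<omega> * \<xi> j \<omega> * ov i j)" .
    have "0 \<le> (LINT s|leb {0..t}. (\<Sum>i\<in>I. \<xi> i \<omega> * indicator {u i<..v i} s)\<^sup>2)"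
      by (intro Bochner_Integration.integral_nonneg) simp
    then show "0 \<le> (\<Sum>i\<in>I. \<Sum>j\<in>I. \<xi> i \<omega> * \<xi> j \<omega> * ov i j)"
      by (simp only: has_bochner_integral_integral_eq [OF hb])
    from hb show "(\<integral>\<^sup>+s. ennreal ((\<Sum>i\<in>I. \<xi> i \<omega> * indicator {u i<..v i} s)\<^sup>2) \<partial>leb {0..t}) =
      ennreal (\<Sum>i\<in>I. \<Sum>j\<in>I. \<xi> i \<omega> * \<xi> j \<omega> * ov i j)"
      by (subst nn_integral_eq_integral) (auto simp: has_bochner_integral_iff)
  qed
  have "(\<integral>\<^sup>+\<omega>. ennreal (\<Sum>i\<in>I. \<Sum>j\<in>I. \<xi> i \<omega> * \<xi> j \<omega> * ov i j) \<partial>M) =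
      ennreal (expectation (\<lambda>\<omega>. \<Sum>i\<in>I. \<Sum>j\<in>I. \<xi> i \<omega> * \<xi> j \<omega> * ov i j))"
    using \<xi>\<xi> inner_nonneg
    by (intro nn_integral_eq_integral Bochner_Integration.integrable_sum) auto
  then show ?thesis
    by (simp add: left inner)
qed

lemma simple_adapted_grid:
  assumes simple: "simple_adapted M F t n \<tau> \<xi>"
  shows "\<And>i j. i \<le> j \<Longrightarrow> j \<le> n \<Longrightarrow> \<tau> i \<le> \<tau> j"
    and "\<And>i. i \<le> n \<Longrightarrow> 0 \<le> \<tau> i" and "\<And>i. i \<le> n \<Longrightarrow> \<tau> i \<le> t"
proof -
  have \<tau>_le: "\<tau> i \<le> \<tau> j" if "i \<le> j" "j \<le> n" for i j
    using that
  proof (induction j rule: dec_induct)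
    case (step j)
    then show ?case
      using simple by (auto simp: simple_adapted_def intro: order_trans)
  qed simp
  have \<tau>0: "0 \<le> \<tau> 0" and \<tau>n: "\<tau> n \<le> t"
    using simple by (auto simp: simple_adapted_def)
  have \<tau>: "0 \<le> \<tau> i" "\<tau> i \<le> t" if "i \<le> n" for i
    using \<tau>_le [of 0 i] \<tau>_le [of i n] \<tau>0 \<tau>n that by auto
  show "\<And>i j. i \<le> j \<Longrightarrow> j \<le> n \<Longrightarrow> \<tau> i \<le> \<tau> j"
    and "\<And>i. i \<le> n \<Longrightarrow> 0 \<le> \<tau> i" and "\<And>i. i \<le> n \<Longrightarrow> \<tau> i \<le> t"
    using \<tau>_le \<tau> by blast+
qed

lemma simple_ito_measurable:
  assumes simple: "simple_adapted M F t n \<tau> \<xi>"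
  shows "simple_ito B n \<tau> \<xi> \<in> borel_measurable M"
proof -
  note \<tau>_le = simple_adapted_grid(1) [OF simple] and \<tau> = simple_adapted_grid(2,3) [OF simple]
  have \<xi>: "\<xi> i \<in> borel_measurable (F (\<tau> i))" "bounded (\<xi> i ` space M)" if "i < n" for i
    using simple that by (auto simp: simple_adapted_def)
  have \<xi>M [measurable]: "\<xi> i \<in> borel_measurable M" if "i < n" for i
    using filtration_measurable [OF \<xi>(1)] \<tau> that by simp
  show ?thesis
    unfolding simple_ito_def [abs_def] using \<tau>
    by (intro borel_measurable_sum borel_measurable_times borel_measurable_diff
        brownian_measurable_M \<xi>M) auto
qed

text \<open>The isometry for the union of both grids, with the coefficients of one of them negated, followed
  by comparison of both integrands with \<open>a\<close> and \<open>(x - y)\<^sup>2 \<le> 2 x\<^sup>2 + 2 y\<^sup>2\<close>.\<close>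

lemma simple_ito_left_sum_distance:
  fixes a :: "real \<Rightarrow> real" and t :: real
  assumes simple: "simple_adapted M F t n \<tau> \<xi>"
    and p: "mono p" "p 0 = 0" "p k = t"
    and a: "(\<lambda>s. a s) \<in> borel_measurable (leb {0..t})"
    and close: "\<And>s. s \<in> {0<..t} \<Longrightarrow>
      \<bar>(\<Sum>i<k. a (p i) * indicator {p i<..p (Suc i)} s) - a s\<bar> < \<delta>"
  shows "(\<integral>\<^sup>+\<omega>. ennreal (((\<Sum>i<k. a (p i) * (B (p (Suc i)) \<omega> - B (p i) \<omega>)) - simple_ito B n \<tau> \<xi> \<omega>)\<^sup>2) \<partial>M) \<le>
    ennreal (2 * \<delta>\<^sup>2 * t) +
    2 * (\<integral>\<^sup>+\<omega>. (\<integral>\<^sup>+s. ennreal ((simple_path n \<tau> \<xi> s \<omega> - a s)\<^sup>2) \<partial>leb {0..t}) \<partial>M)"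
proof -
  have p_le: "p i \<le> p j" if "i \<le> j" for i j
    using monoD [OF p(1) that] .
  have t: "0 \<le> t"
    using p_le [of 0 k] p by simp
  note \<tau>_le = simple_adapted_grid(1) [OF simple] and \<tau> = simple_adapted_grid(2,3) [OF simple]
  have \<xi>: "\<xi> i \<in> borel_measurable (F (\<tau> i))" "bounded (\<xi> i ` space M)" if "i < n" for i
    using simple that by (auto simp: simple_adapted_def)
  have \<xi>M [measurable]: "\<xi> i \<in> borel_measurable M" if "i < n" for i
    using filtration_measurable [OF \<xi>(1)] \<tau> that by simp
  interpret leb: finite_measure "leb {0..t}"
    using t by (intro finite_measureI) (simp add: emeasure_restrict_space space_restrict_space)
  let ?path = "\<lambda>s \<omega>. simple_path n \<tau> \<xi> s \<omega>"
  let ?step = "\<lambda>s. \<Sum>i<k. a (p i) * indicator {p i<..p (Suc i)} s"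
  define I where "I = {..<n} <+> {..<k}"
  define u where "u = case_sum \<tau> p"
  define v where "v = case_sum (\<lambda>i. \<tau> (Suc i)) (\<lambda>i. p (Suc i))"
  define \<zeta> where "\<zeta> = case_sum (\<lambda>i \<omega>. - \<xi> i \<omega>) (\<lambda>i \<omega>. a (p i))"
  have sums: "(\<Sum>i\<in>I. \<zeta> i \<omega> * (B (v i) \<omega> - B (u i) \<omega>)) =
      (\<Sum>i<k. a (p i) * (B (p (Suc i)) \<omega> - B (p i) \<omega>)) - simple_ito B n \<tau> \<xi> \<omega>"
    and paths: "(\<Sum>i\<in>I. \<zeta> i \<omega> * indicator {u i<..v i} s) = ?step s - ?path s \<omega>" for \<omega> s
    unfolding I_def u_def v_def \<zeta>_def simple_ito_def simple_path_def
      sum.Plus [OF finite_lessThan finite_lessThan] o_def sum.case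
    by (simp_all add: sum_negf)
  have "(\<integral>\<^sup>+\<omega>. ennreal ((\<Sum>i\<in>I. \<zeta> i \<omega> * (B (v i) \<omega> - B (u i) \<omega>))\<^sup>2) \<partial>M) =
    (\<integral>\<^sup>+\<omega>. (\<integral>\<^sup>+s. ennreal ((\<Sum>i\<in>I. \<zeta> i \<omega> * indicator {u i<..v i} s)\<^sup>2) \<partial>leb {0..t}) \<partial>M)"
  proof (rule ito_isometry_family)
    show "finite I"
      by (simp add: I_def)
    fix i assume "i \<in> I"
    then consider j where "i = Inl j" "j < n" | j where "i = Inr j" "j < k"
      by (auto simp: I_def)
    then have "(0 \<le> u i \<and> u i \<le> v i \<and> v i \<le> t) \<and> \<zeta> i \<in> borel_measurable (F (u i)) \<and>
      bounded (\<zeta> i ` space M)"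
    proof cases
      case 1
      then have "0 \<le> u i \<and> u i \<le> v i \<and> v i \<le> t"
        using \<tau>_le [of j "Suc j"] \<tau> [of j] \<tau> [of "Suc j"] by (simp add: u_def v_def)
      moreover have "\<zeta> i \<in> borel_measurable (F (u i))"
        using \<xi>(1) [of j] 1 by (simp add: u_def \<zeta>_def)
      moreover have "bounded (\<zeta> i ` space M)"
        using \<xi>(2) [of j] 1 by (simp add: \<zeta>_def bounded_iff)
      ultimately show ?thesis
        by blast
    next
      case 2
      then have "0 \<le> u i \<and> u i \<le> v i \<and> v i \<le> t"
        using p_le [of 0 j] p_le [of j "Suc j"] p_le [of "Suc j" k] p by (simp add: u_def v_def)
      moreover have "\<zeta> i \<in> borel_measurable (F (u i))" "bounded (\<zeta> i ` space M)"
        using 2 by (auto simp: \<zeta>_def bounded_iff)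
      ultimately show ?thesis
        by blast
    qed
    then show "0 \<le> u i \<and> u i \<le> v i \<and> v i \<le> t" "\<zeta> i \<in> borel_measurable (F (u i))"
      "bounded (\<zeta> i ` space M)"
      by blast+
  qed
  also have "\<dots> \<le> (\<integral>\<^sup>+\<omega>. (\<integral>\<^sup>+s. ennreal (2 * \<delta>\<^sup>2) + 2 * ennreal ((?path s \<omega> - a s)\<^sup>2) \<partial>leb {0..t}) \<partial>M)"
  proof (rule nn_integral_mono, rule nn_integral_mono_AE)
    fix \<omega>
    have "AE s in lborel. s \<noteq> (0::real)"
      by (rule AE_lborel_singleton)
    then have "AE s in leb {0..t}. s \<in> {0<..t}"
      by (subst AE_restrict_space_iff) auto
    then show "AE s in leb {0..t}. ennreal ((\<Sum>i\<in>I. \<zeta> i \<omega> * indicator {u i<..v i} s)\<^sup>2) \<le>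
        ennreal (2 * \<delta>\<^sup>2) + 2 * ennreal ((?path s \<omega> - a s)\<^sup>2)"
    proof eventually_elim
      case (elim s)
      have "(?step s - a s)\<^sup>2 \<le> \<delta>\<^sup>2"
        using close [OF elim] by (intro abs_le_square_iff [THEN iffD1]) simp
      moreover have "0 \<le> ((?step s - a s) + (?path s \<omega> - a s))\<^sup>2"
        by simp
      then have "(?step s - ?path s \<omega>)\<^sup>2 \<le> 2 * (?step s - a s)\<^sup>2 + 2 * (?path s \<omega> - a s)\<^sup>2"
        by (simp only: power2_eq_square) (simp only: algebra_simps)
      ultimately have "(?step s - ?path s \<omega>)\<^sup>2 \<le> 2 * \<delta>\<^sup>2 + 2 * (?path s \<omega> - a s)\<^sup>2"
        by linarith
      then have "ennreal ((?step s - ?path s \<omega>)\<^sup>2) \<le> ennreal (2 * \<delta>\<^sup>2 + 2 * (?path s \<omega> - a s)\<^sup>2)"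
        by (rule ennreal_leI)
      also have "\<dots> = ennreal (2 * \<delta>\<^sup>2) + 2 * ennreal ((?path s \<omega> - a s)\<^sup>2)"
        by (simp add: ennreal_plus ennreal_mult')
      finally show ?case
        by (simp only: paths)
    qed
  qed
  also have "\<dots> = (\<integral>\<^sup>+\<omega>. ennreal (2 * \<delta>\<^sup>2) * ennreal t +
      2 * (\<integral>\<^sup>+s. ennreal ((?path s \<omega> - a s)\<^sup>2) \<partial>leb {0..t}) \<partial>M)"
  proof (intro nn_integral_cong)
    fix \<omega>
    have [measurable]: "(\<lambda>s. ?path s \<omega>) \<in> borel_measurable (leb {0..t})"
      unfolding simple_path_def
      by (intro borel_measurable_sum borel_measurable_times borel_measurable_const
          measurable_restrict_space1 borel_measurable_indicator) auto
    note a [measurable]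
    have "emeasure (leb {0..t}) {0..t} = ennreal t"
      using t by (simp add: emeasure_restrict_space)
    then show "(\<integral>\<^sup>+s. ennreal (2 * \<delta>\<^sup>2) + 2 * ennreal ((?path s \<omega> - a s)\<^sup>2) \<partial>leb {0..t}) =
        ennreal (2 * \<delta>\<^sup>2) * ennreal t + 2 * (\<integral>\<^sup>+s. ennreal ((?path s \<omega> - a s)\<^sup>2) \<partial>leb {0..t})"
      by (simp add: nn_integral_add nn_integral_cmult space_restrict_space)
  qed
  also have "\<dots> = ennreal (2 * \<delta>\<^sup>2 * t) +
      2 * (\<integral>\<^sup>+\<omega>. (\<integral>\<^sup>+s. ennreal ((?path s \<omega> - a s)\<^sup>2) \<partial>leb {0..t}) \<partial>M)"
  proof -
    have 1: "(\<lambda>(\<omega>, s). indicator {\<tau> i<..\<tau> (Suc i)} s :: real) \<in> borel_measurable (M \<Otimes>\<^sub>M leb {0..t})" for i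
      unfolding split_def
      by (intro measurable_compose [OF measurable_snd] measurable_restrict_space1
          borel_measurable_indicator) auto
    have "(\<lambda>(\<omega>, s). ?path s \<omega>) \<in> borel_measurable (M \<Otimes>\<^sub>M leb {0..t})"
      unfolding simple_path_def split_def
      by (intro borel_measurable_sum borel_measurable_times 1 [unfolded split_def]
          measurable_compose [OF measurable_fst] \<xi>M) auto
    moreover have "(\<lambda>(\<omega>, s). a s) \<in> borel_measurable (M \<Otimes>\<^sub>M leb {0..t})"
      unfolding split_def by (intro measurable_compose [OF measurable_snd] a)
    ultimately have "(\<lambda>(\<omega>, s). ennreal ((?path s \<omega> - a s)\<^sup>2)) \<in> borel_measurable (M \<Otimes>\<^sub>M leb {0..t})"
      unfolding split_def by measurable
    then have "(\<lambda>\<omega>. \<integral>\<^sup>+s. ennreal ((?path s \<omega> - a s)\<^sup>2) \<partial>leb {0..t}) \<in> borel_measurable M"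
      by (intro leb.borel_measurable_nn_integral) (simp add: split_def)
    then show ?thesis
      using t by (simp add: nn_integral_add nn_integral_cmult emeasure_space_1 ennreal_mult')
  qed
  finally show ?thesis
    by (simp only: sums)
qed

text \<open>Whatever random simple processes define \<open>X\<close>, the deterministic left-point sums converge to it.
  This identifies \<open>X\<close> as a limit of functions of \<open>B\<close> alone, which is what gives access to its
  exponential moments and to independence.\<close>

lemma ito_left_sums_L2:
  fixes a :: "real \<Rightarrow> real" and t :: real
  assumes ito: "has_ito_integral M F B t (\<lambda>s \<omega>. a s) X"
    and a: "continuous_on {0..t} a" and t: "0 < t"
  shows "(\<lambda>k. \<integral>\<^sup>+\<omega>. ennreal (((\<Sum>i<Suc k. a (t * i / Suc k) *
    (B (t * Suc i / Suc k) \<omega> - B (t * i / Suc k) \<omega>)) - X \<omega>)\<^sup>2) \<partial>M) \<longlonglongrightarrow> 0"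
proof (rule ennreal_tendsto_zeroI)
  fix e :: real assume e: "0 < e"
  \<comment> \<open>Chosen so that \<open>4 \<delta>\<^sup>2 t = e\<close>, the limit of the bound below as \<open>m\<close> tends to infinity.\<close>
  define \<delta> where "\<delta> = sqrt (e / (4 * t))"
  have \<delta>: "0 < \<delta>" "2 * (2 * \<delta>\<^sup>2 * t) = e"
    using e t by (simp_all add: \<delta>_def)
  obtain n \<tau> \<xi> where simple: "\<And>m::nat. simple_adapted M F t (n m) (\<tau> m) (\<xi> m)"
    and lim1: "(\<lambda>m. \<integral>\<^sup>+\<omega>. (\<integral>\<^sup>+s. ennreal ((simple_path (n m) (\<tau> m) (\<xi> m) s \<omega> - a s)\<^sup>2)
        \<partial>leb {0..t}) \<partial>M) \<longlonglongrightarrow> 0"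
    and lim2: "(\<lambda>m. \<integral>\<^sup>+\<omega>. ennreal ((simple_ito B (n m) (\<tau> m) (\<xi> m) \<omega> - X \<omega>)\<^sup>2) \<partial>M) \<longlonglongrightarrow> 0"
    using ito unfolding has_ito_integral_def by blast
  have X [measurable]: "X \<in> borel_measurable M"
    using ito by (simp add: has_ito_integral_def)
  have a_meas: "a \<in> borel_measurable (leb {0..t})"
    using borel_measurable_continuous_on_restrict [OF a] by (simp cong: measurable_cong_sets)
  show "\<forall>\<^sub>F k in sequentially. (\<integral>\<^sup>+\<omega>. ennreal (((\<Sum>i<Suc k. a (t * i / Suc k) *
    (B (t * Suc i / Suc k) \<omega> - B (t * i / Suc k) \<omega>)) - X \<omega>)\<^sup>2) \<partial>M) \<le> ennreal e"
    using left_step_close [OF a t \<delta>(1)]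
  proof eventually_elim
    case (elim k)
    define p where "p i = t * real i / Suc k" for i
    have p: "mono p" "p 0 = 0" "p (Suc k) = t" "0 \<le> p i" for i
      using t by (auto simp: p_def mono_def intro!: divide_right_mono mult_left_mono)
    define S where "S \<omega> = (\<Sum>i<Suc k. a (p i) * (B (p (Suc i)) \<omega> - B (p i) \<omega>))" for \<omega>
    have S [measurable]: "S \<in> borel_measurable M"
      unfolding S_def using p
      by (intro borel_measurable_sum borel_measurable_times borel_measurable_diff
          borel_measurable_const brownian_measurable_M)
    have "(\<integral>\<^sup>+\<omega>. ennreal ((S \<omega> - X \<omega>)\<^sup>2) \<partial>M) \<le>
        2 * (ennreal (2 * \<delta>\<^sup>2 * t) + 2 * (\<integral>\<^sup>+\<omega>. (\<integral>\<^sup>+s.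
          ennreal ((simple_path (n m) (\<tau> m) (\<xi> m) s \<omega> - a s)\<^sup>2) \<partial>leb {0..t}) \<partial>M)) +
        2 * (\<integral>\<^sup>+\<omega>. ennreal ((simple_ito B (n m) (\<tau> m) (\<xi> m) \<omega> - X \<omega>)\<^sup>2) \<partial>M)" for m
    proof -
      let ?Y = "simple_ito B (n m) (\<tau> m) (\<xi> m)"
      have Y [measurable]: "?Y \<in> borel_measurable M"
        by (rule simple_ito_measurable [OF simple])
      have "(\<integral>\<^sup>+\<omega>. ennreal ((S \<omega> - X \<omega>)\<^sup>2) \<partial>M) \<le>
          (\<integral>\<^sup>+\<omega>. 2 * ennreal ((S \<omega> - ?Y \<omega>)\<^sup>2) + 2 * ennreal ((?Y \<omega> - X \<omega>)\<^sup>2) \<partial>M)"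
      proof (rule nn_integral_mono)
        fix \<omega>
        have "0 \<le> ((S \<omega> - ?Y \<omega>) - (?Y \<omega> - X \<omega>))\<^sup>2"
          by simp
        then have "(S \<omega> - X \<omega>)\<^sup>2 \<le> 2 * (S \<omega> - ?Y \<omega>)\<^sup>2 + 2 * (?Y \<omega> - X \<omega>)\<^sup>2"
          by (simp only: power2_eq_square) (simp only: algebra_simps)
        then have "ennreal ((S \<omega> - X \<omega>)\<^sup>2) \<le> ennreal (2 * (S \<omega> - ?Y \<omega>)\<^sup>2 + 2 * (?Y \<omega> - X \<omega>)\<^sup>2)"
          by (rule ennreal_leI)
        then show "ennreal ((S \<omega> - X \<omega>)\<^sup>2) \<le>
            2 * ennreal ((S \<omega> - ?Y \<omega>)\<^sup>2) + 2 * ennreal ((?Y \<omega> - X \<omega>)\<^sup>2)"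
          by (simp add: ennreal_plus ennreal_mult')
      qed
      also have "\<dots> = 2 * (\<integral>\<^sup>+\<omega>. ennreal ((S \<omega> - ?Y \<omega>)\<^sup>2) \<partial>M) + 2 * (\<integral>\<^sup>+\<omega>. ennreal ((?Y \<omega> - X \<omega>)\<^sup>2) \<partial>M)"
        by (simp add: nn_integral_add nn_integral_cmult)
      also have "(\<integral>\<^sup>+\<omega>. ennreal ((S \<omega> - ?Y \<omega>)\<^sup>2) \<partial>M) \<le> ennreal (2 * \<delta>\<^sup>2 * t) + 2 * (\<integral>\<^sup>+\<omega>. (\<integral>\<^sup>+s.
          ennreal ((simple_path (n m) (\<tau> m) (\<xi> m) s \<omega> - a s)\<^sup>2) \<partial>leb {0..t}) \<partial>M)"
        unfolding S_def
      proof (rule simple_ito_left_sum_distance [OF simple p(1,2,3) a_meas])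
        fix s assume "s \<in> {0<..t}"
        then show "\<bar>(\<Sum>i<Suc k. a (p i) * indicator {p i<..p (Suc i)} s) - a s\<bar> < \<delta>"
          using elim unfolding p_def by blast
      qed
      finally show ?thesis
        by (simp add: mult_left_mono add_right_mono)
    qed
    moreover have "(\<lambda>m. 2 * (ennreal (2 * \<delta>\<^sup>2 * t) + 2 * (\<integral>\<^sup>+\<omega>. (\<integral>\<^sup>+s.
          ennreal ((simple_path (n m) (\<tau> m) (\<xi> m) s \<omega> - a s)\<^sup>2) \<partial>leb {0..t}) \<partial>M)) +
        2 * (\<integral>\<^sup>+\<omega>. ennreal ((simple_ito B (n m) (\<tau> m) (\<xi> m) \<omega> - X \<omega>)\<^sup>2) \<partial>M)) \<longlonglongrightarrow>
        2 * (ennreal (2 * \<delta>\<^sup>2 * t) + 2 * 0) + 2 * 0"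
      by (intro tendsto_add ennreal_tendsto_cmult lim1 lim2 tendsto_const) auto
    ultimately have "(\<integral>\<^sup>+\<omega>. ennreal ((S \<omega> - X \<omega>)\<^sup>2) \<partial>M) \<le> 2 * (ennreal (2 * \<delta>\<^sup>2 * t) + 2 * 0) + 2 * 0"
      by (intro LIMSEQ_le_const) auto
    also have "\<dots> = ennreal (2 * (2 * \<delta>\<^sup>2 * t))"
      using ennreal_mult' [of 2 "2 * \<delta>\<^sup>2 * t"]
      by (simp only: mult_zero_right add_0_right ennreal_numeral zero_le_numeral)
    finally show ?case
      unfolding \<delta>(2) S_def p_def .
  qed
qed

lemma ito_left_sums_AE_subseq:
  fixes a :: "real \<Rightarrow> real" and t :: real
  assumes ito: "has_ito_integral M F B t (\<lambda>s \<omega>. a s) X"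
    and a: "continuous_on {0..t} a" and t: "0 < t"
  shows "\<exists>r. strict_mono r \<and> (AE \<omega> in M. (\<lambda>n. \<Sum>i<Suc (r n). a (t * i / Suc (r n)) *
    (B (t * Suc i / Suc (r n)) \<omega> - B (t * i / Suc (r n)) \<omega>)) \<longlonglongrightarrow> X \<omega>)"
proof (rule L2_tendsto_AE_subseq [OF _ _ ito_left_sums_L2 [OF ito a t]])
  show "(\<lambda>\<omega>. \<Sum>i<Suc n. a (t * i / Suc n) * (B (t * Suc i / Suc n) \<omega> - B (t * i / Suc n) \<omega>))
      \<in> borel_measurable M" for n
    using t by (intro borel_measurable_sum borel_measurable_times borel_measurable_diff
        borel_measurable_const brownian_measurable_M) auto
  show "X \<in> borel_measurable M"
    using ito by (simp add: has_ito_integral_def)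
qed

lemma ito_left_sum_exp:
  fixes a :: "real \<Rightarrow> real" and t :: real
  assumes t: "0 < t"
  shows "(\<integral>\<^sup>+\<omega>. ennreal (exp (\<theta> * (\<Sum>i<Suc n. a (t * i / Suc n) *
    (B (t * Suc i / Suc n) \<omega> - B (t * i / Suc n) \<omega>)))) \<partial>M) =
    ennreal (exp (\<theta>\<^sup>2 / 2 * (\<Sum>i<Suc n. (a (t * i / Suc n))\<^sup>2 * (t / Suc n))))"
proof -
  define p where "p i = t * real i / real (Suc n)" for i :: nat
  have p: "mono p" "0 \<le> p 0"
    using t by (auto simp: p_def mono_def intro!: divide_right_mono mult_left_mono)
  have step: "p (Suc i) - p i = t / Suc n" for i
    unfolding p_def diff_divide_distrib [symmetric] by (simp add: algebra_simps)
  show ?thesis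
    using brownian_sum_exp [OF p, of \<theta> "\<lambda>i. a (p i)" "Suc n"]
    unfolding step unfolding p_def .
qed

lemma ito_exp_le:
  fixes a :: "real \<Rightarrow> real" and t :: real
  assumes ito: "has_ito_integral M F B t (\<lambda>s \<omega>. a s) X"
    and a: "continuous_on {0..t} a" and t: "0 < t"
  shows "(\<integral>\<^sup>+\<omega>. ennreal (exp (\<theta> * X \<omega>)) \<partial>M) \<le> ennreal (exp (\<theta>\<^sup>2 / 2 * sq_int a t))"
proof -
  let ?S = "\<lambda>n \<omega>. \<Sum>i<Suc n. a (t * i / Suc n) * (B (t * Suc i / Suc n) \<omega> - B (t * i / Suc n) \<omega>)"
  obtain r where r: "strict_mono r" and lim: "AE \<omega> in M. (\<lambda>n. ?S (r n) \<omega>) \<longlonglongrightarrow> X \<omega>"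
    using ito_left_sums_AE_subseq [OF ito a t] by blast
  show ?thesis
  proof (rule nn_integral_exp_limit_le)
    show "(\<lambda>\<omega>. \<theta> * ?S (r n) \<omega>) \<in> borel_measurable M" for n
      using t by (intro borel_measurable_sum borel_measurable_times borel_measurable_diff
          borel_measurable_const brownian_measurable_M) auto
    show "AE \<omega> in M. (\<lambda>n. \<theta> * ?S (r n) \<omega>) \<longlonglongrightarrow> \<theta> * X \<omega>"
      using lim by eventually_elim (rule tendsto_mult_left)
    show "(\<integral>\<^sup>+\<omega>. ennreal (exp (\<theta> * ?S (r n) \<omega>)) \<partial>M) \<le>
        ennreal (exp (\<theta>\<^sup>2 / 2 * (\<Sum>i<Suc (r n). (a (t * i / Suc (r n)))\<^sup>2 * (t / Suc (r n)))))" for n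
      by (simp only: ito_left_sum_exp [OF t] order_refl)
    have "continuous_on {0..t} (\<lambda>s. (a s)\<^sup>2)"
      using a by (intro continuous_intros)
    from LIMSEQ_subseq_LIMSEQ [OF left_riemann_sums_tendsto [OF this t] r]
    show "(\<lambda>n. \<theta>\<^sup>2 / 2 * (\<Sum>i<Suc (r n). (a (t * i / Suc (r n)))\<^sup>2 * (t / Suc (r n)))) \<longlonglongrightarrow>
        \<theta>\<^sup>2 / 2 * sq_int a t"
      unfolding sq_int_def o_def by (rule tendsto_mult_left)
  qed
qed

text \<open>The left-point sums of both integrals are functions of the paths of \<open>B\<close> and \<open>X\<close>, so
  independence factorizes their joint exponential moments before the passage to the limit.\<close>

lemma ito_stieltjes_exp_le_indep:
  fixes a b :: "real \<Rightarrow> real" and t :: real and X :: "real \<Rightarrow> 'a \<Rightarrow> real"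
  assumes ito: "has_ito_integral M F B t (\<lambda>s \<omega>. a s) I"
    and a: "continuous_on {0..t} a" and t: "0 < t"
    and fbm: "fractional_brownian_motion M H X" and H: "1 / 2 < H"
    and b: "continuous_on {0..t} b"
    and J: "AE \<omega> in M. has_rs_integral b (\<lambda>s. X s \<omega>) 0 t (J \<omega>)"
    and indep: "independent_processes M B X"
  shows "(\<integral>\<^sup>+\<omega>. ennreal (exp (\<theta> * (I \<omega> + J \<omega>))) \<partial>M) \<le>
    ennreal (exp (\<theta>\<^sup>2 / 2 * sq_int a t + \<theta>\<^sup>2 * H * t powr (2 * H - 1) * sq_int b t))"
proof -
  define p where "p n i = t * real i / real (Suc n)" for n i :: nat
  have p: "mono (p n)" "p n 0 = 0" "p n (Suc n) = t" "0 \<le> p n i" for n i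
    using t by (auto simp: p_def mono_def intro!: divide_right_mono mult_left_mono)
  have step: "p n (Suc i) - p n i = t / Suc n" for n i
    unfolding p_def diff_divide_distrib [symmetric] by (simp add: algebra_simps)
  let ?s = "\<lambda>c n x. \<Sum>i<Suc n. c (p n i) * (x (p n (Suc i)) - x (p n i))"
  let ?S = "\<lambda>n \<omega>. ?s a n (\<lambda>s. B s \<omega>)" and ?R = "\<lambda>n \<omega>. ?s b n (\<lambda>s. X s \<omega>)"
  let ?v = "\<lambda>n. \<Sum>i<Suc n. (a (p n i))\<^sup>2 * (t / Suc n)"
  let ?w = "\<lambda>n. \<Sum>i<Suc n. (b (p n i))\<^sup>2 * (t / Suc n)"
  obtain r where r: "strict_mono r" and lim: "AE \<omega> in M. (\<lambda>n. ?S (r n) \<omega>) \<longlonglongrightarrow> I \<omega>"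
    using ito_left_sums_AE_subseq [OF ito a t] unfolding p_def by blast
  show ?thesis
  proof (rule nn_integral_exp_limit_le)
    have S: "?S n \<in> borel_measurable M" for n
      using p by (intro borel_measurable_sum borel_measurable_times borel_measurable_diff
          borel_measurable_const brownian_measurable_M)
    have R: "?R n \<in> borel_measurable M" for n
      using p by (intro borel_measurable_sum borel_measurable_times borel_measurable_diff
          borel_measurable_const fbm_measurable [OF fbm H])
    show "(\<lambda>\<omega>. \<theta> * (?S (r n) \<omega> + ?R (r n) \<omega>)) \<in> borel_measurable M" for n
      by (intro borel_measurable_times borel_measurable_add borel_measurable_const S R)
    show "AE \<omega> in M. (\<lambda>n. \<theta> * (?S (r n) \<omega> + ?R (r n) \<omega>)) \<longlonglongrightarrow> \<theta> * (I \<omega> + J \<omega>)"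
      using lim J
    proof eventually_elim
      case (elim \<omega>)
      have "(\<lambda>n. ?R n \<omega>) \<longlonglongrightarrow> J \<omega>"
        unfolding p_def by (intro has_rs_integral_left_sums elim t)
      from LIMSEQ_subseq_LIMSEQ [OF this r] show ?case
        unfolding o_def by (intro tendsto_mult_left tendsto_add elim)
    qed
    show "(\<integral>\<^sup>+\<omega>. ennreal (exp (\<theta> * (?S (r n) \<omega> + ?R (r n) \<omega>))) \<partial>M) \<le>
        ennreal (exp (\<theta>\<^sup>2 / 2 * ?v (r n) + \<theta>\<^sup>2 * H * t powr (2 * H - 1) * ?w (r n)))" for n
    proof -
      let ?n = "r n"
      have meas: "(\<lambda>x. ennreal (exp (\<theta> * ?s c ?n x))) \<in> borel_measurable (PiM {0..} (\<lambda>_. borel))" for c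
        using p by (intro measurable_compose [OF _ measurable_ennreal] measurable_compose [OF _ borel_measurable_exp]
          borel_measurable_times borel_measurable_const
          borel_measurable_sum borel_measurable_diff measurable_component_singleton) auto
      have "indep_var (PiM {0..} (\<lambda>_. borel)) (\<lambda>\<omega>. \<lambda>s\<in>{0..}. B s \<omega>)
          (PiM {0..} (\<lambda>_. borel)) (\<lambda>\<omega>. \<lambda>s\<in>{0..}. X s \<omega>)"
        using indep by (simp add: independent_processes_def)
      from indep_var_compose [OF this meas [of a] meas [of b]]
      have "indep_var borel (\<lambda>\<omega>. ennreal (exp (\<theta> * ?S ?n \<omega>))) borel (\<lambda>\<omega>. ennreal (exp (\<theta> * ?R ?n \<omega>)))"
        using p(4) by (simp add: o_def del: sum.lessThan_Suc)
      from indep_var_nn_integral_mult [OF this]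
      have "(\<integral>\<^sup>+\<omega>. ennreal (exp (\<theta> * (?S ?n \<omega> + ?R ?n \<omega>))) \<partial>M) =
          (\<integral>\<^sup>+\<omega>. ennreal (exp (\<theta> * ?S ?n \<omega>)) \<partial>M) * (\<integral>\<^sup>+\<omega>. ennreal (exp (\<theta> * ?R ?n \<omega>)) \<partial>M)"
        by (simp only: distrib_left exp_add ennreal_mult' exp_ge_zero)
      also have "\<dots> \<le> ennreal (exp (\<theta>\<^sup>2 / 2 * ?v ?n)) *
          ennreal (exp (\<theta>\<^sup>2 * H * t powr (2 * H - 1) * ?w ?n))"
      proof (rule mult_mono)
        show "(\<integral>\<^sup>+\<omega>. ennreal (exp (\<theta> * ?S ?n \<omega>)) \<partial>M) \<le> ennreal (exp (\<theta>\<^sup>2 / 2 * ?v ?n))"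
          unfolding p_def by (simp only: ito_left_sum_exp [OF t] order_refl)
        show "(\<integral>\<^sup>+\<omega>. ennreal (exp (\<theta> * ?R ?n \<omega>)) \<partial>M) \<le>
            ennreal (exp (\<theta>\<^sup>2 * H * t powr (2 * H - 1) * ?w ?n))"
          using fbm_sum_exp_le [OF fbm H p(1,2,3), of \<theta> "\<lambda>i. b (p ?n i)" ?n]
          unfolding step .
      qed simp_all
      finally show ?thesis
        by (simp only: exp_add ennreal_mult' exp_ge_zero)
    qed
    have lims: "(\<lambda>n. \<Sum>i<Suc (r n). (c (p (r n) i))\<^sup>2 * (t / Suc (r n))) \<longlonglongrightarrow> sq_int c t"
      if "continuous_on {0..t} c" for c
    proof -
      have "continuous_on {0..t} (\<lambda>s. (c s)\<^sup>2)"
        using that by (intro continuous_intros)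
      from LIMSEQ_subseq_LIMSEQ [OF left_riemann_sums_tendsto [OF this t] r] show ?thesis
        unfolding sq_int_def o_def p_def .
    qed
    show "(\<lambda>n. \<theta>\<^sup>2 / 2 * ?v (r n) + \<theta>\<^sup>2 * H * t powr (2 * H - 1) * ?w (r n)) \<longlonglongrightarrow>
        \<theta>\<^sup>2 / 2 * sq_int a t + \<theta>\<^sup>2 * H * t powr (2 * H - 1) * sq_int b t"
      by (intro tendsto_add tendsto_mult_left lims a b)
  qed
qed

end

end

section \<open>The probability of an early blowup\<close>

lemma locally_hoelder_continuous_on:
  assumes "locally_hoelder \<alpha> f" "0 < \<alpha>"
  shows "continuous_on {0..R} f"
  unfolding continuous_on_def
proof
  fix x assume x: "x \<in> {0..R}"
  obtain c where c: "\<And>s t. s \<in> {0..R} \<Longrightarrow> t \<in> {0..R} \<Longrightarrow> \<bar>f s - f t\<bar> \<le> c * \<bar>s - t\<bar> powr \<alpha>"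
    using assms(1) unfolding locally_hoelder_def by blast
  have "((\<lambda>s. c * \<bar>s - x\<bar> powr \<alpha>) \<longlongrightarrow> c * 0) (at x within {0..R})"
  proof (intro tendsto_mult_left tendsto_zero_powrI)
    show "((\<lambda>s. \<bar>s - x\<bar>) \<longlongrightarrow> 0) (at x within {0..R})"
      by (intro tendsto_rabs_zero LIM_zero tendsto_ident_at)
    show "((\<lambda>s. \<alpha>) \<longlongrightarrow> \<alpha>) (at x within {0..R})"
      by (rule tendsto_const)
    show "\<forall>\<^sub>F s in at x within {0..R}. 0 \<le> \<bar>s - x\<bar>"
      by (intro always_eventually) simp
  qed (fact assms(2))
  moreover have "\<forall>\<^sub>F s in at x within {0..R}. norm (f s - f x) \<le> c * \<bar>s - x\<bar> powr \<alpha>"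
    unfolding eventually_at_filter using c [OF _ x] by (intro always_eventually) simp
  ultimately have "((\<lambda>s. f s - f x) \<longlongrightarrow> 0) (at x within {0..R})"
    unfolding mult_zero_right by (rule Lim_null_comparison [rotated])
  then show "(f \<longlongrightarrow> f x) (at x within {0..R})"
    by (rule LIM_zero_cancel)
qed

text \<open>Monotonicity supplies both measurability in time and bounds on \<open>[0, T]\<close>.\<close>

lemma sq_int_mono:
  assumes "\<And>t. 0 \<le> t \<Longrightarrow> set_integrable lborel {0..t} (\<lambda>r. (f r)\<^sup>2)"
  shows "mono (sq_int f)"
proof
  fix s t :: real assume "s \<le> t"
  have int: "set_integrable lborel {0..t} (\<lambda>r. (f r)\<^sup>2)" for t
    using assms [of t] by (cases "0 \<le> t") (auto simp: set_integrable_def)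
  show "sq_int f s \<le> sq_int f t"
    unfolding sq_int_def set_lebesgue_integral_def
    using int [of s] int [of t] \<open>s \<le> t\<close> unfolding set_integrable_def
    by (intro integral_mono) (auto simp: indicator_def)
qed

lemma sq_int_nonneg: "0 \<le> sq_int f t"
  unfolding sq_int_def set_lebesgue_integral_def
  by (intro Bochner_Integration.integral_nonneg) auto

lemma set_integrable_square_of_continuous:
  fixes f :: "real \<Rightarrow> real"
  assumes "continuous_on {0..t} f"
  shows "set_integrable lborel {0..t} (\<lambda>r. (f r)\<^sup>2)"
  using assms by (intro borel_integrable_atLeastAtMost' continuous_intros)

lemma set_integrable_exp_bounded_above:
  fixes f :: "real \<Rightarrow> real"
  assumes [measurable]: "f \<in> borel_measurable borel" and "\<And>t. t \<in> {0..T} \<Longrightarrow> f t \<le> c"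
  shows "set_integrable lborel {0..T} (\<lambda>t. exp (f t))"
proof -
  have "set_integrable lborel {0..T} (\<lambda>t. exp c)"
    by (intro borel_integrable_atLeastAtMost' continuous_intros)
  then show ?thesis
    by (rule set_integrable_bound) (use assms in \<open>auto simp: set_borel_measurable_def\<close>)
qed

text \<open>Continuity of paths makes the process the limit of its values at the grid points \<open>\<lfloor>t n\<rfloor> / n\<close>,
  which depend on \<open>t\<close> through countably many values only.\<close>

lemma continuous_process_measurable:
  fixes Y :: "real \<Rightarrow> 'a \<Rightarrow> real"
  assumes meas: "\<And>t. Y t \<in> borel_measurable M"
    and cont: "\<And>\<omega>. \<omega> \<in> space M \<Longrightarrow> continuous_on UNIV (\<lambda>t. Y t \<omega>)"
  shows "(\<lambda>(t, \<omega>). Y t \<omega>) \<in> borel_measurable (lborel \<Otimes>\<^sub>M M)"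
proof (rule borel_measurable_LIMSEQ_real)
  let ?d = "\<lambda>n t. real_of_int \<lfloor>t * real (Suc n)\<rfloor> / real (Suc n)"
  show "(\<lambda>(t, \<omega>). Y (?d n t) \<omega>) \<in> borel_measurable (lborel \<Otimes>\<^sub>M M)" for n
  proof -
    have "(\<lambda>z. Y (real_of_int i / real (Suc n)) (snd z)) \<in> borel_measurable (lborel \<Otimes>\<^sub>M M)" for i
      by (intro measurable_compose [OF measurable_snd] meas)
    moreover have "(\<lambda>z. \<lfloor>fst z * real (Suc n)\<rfloor>) \<in> lborel \<Otimes>\<^sub>M M \<rightarrow>\<^sub>M count_space UNIV"
      by measurable
    ultimately show ?thesis
      unfolding split_def by (rule measurable_compose_countable)
  qed
  fix z :: "real \<times> 'a" assume "z \<in> space (lborel \<Otimes>\<^sub>M M)"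
  then obtain t :: real and \<omega> where z: "z = (t, \<omega>)" "\<omega> \<in> space M"
    by (auto simp: space_pair_measure)
  have "(\<lambda>n. ?d n t) \<longlonglongrightarrow> t"
  proof (rule LIMSEQ_I)
    fix e :: real assume "0 < e"
    then obtain n0 :: nat where n0: "1 / e < n0"
      using reals_Archimedean2 by blast
    have "norm (?d n t - t) < e" if "n0 \<le> n" for n
    proof -
      have "1 / e < Suc n"
        using n0 that by simp
      then have "1 / Suc n < e"
        using \<open>0 < e\<close> by (simp add: field_simps)
      have "\<bar>real_of_int \<lfloor>t * real (Suc n)\<rfloor> - t * real (Suc n)\<bar> \<le> 1"
        by linarith
      then have "\<bar>real_of_int \<lfloor>t * real (Suc n)\<rfloor> - t * real (Suc n)\<bar> / Suc n \<le> 1 / Suc n"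
        by (intro divide_right_mono) auto
      also have "\<bar>real_of_int \<lfloor>t * real (Suc n)\<rfloor> - t * real (Suc n)\<bar> / Suc n =
          \<bar>(real_of_int \<lfloor>t * real (Suc n)\<rfloor> - t * real (Suc n)) / Suc n\<bar>"
        by (simp only: abs_divide abs_of_nat)
      also have "(real_of_int \<lfloor>t * real (Suc n)\<rfloor> - t * real (Suc n)) / Suc n = ?d n t - t"
        by (simp add: diff_divide_distrib del: of_nat_Suc)
      finally show ?thesis
        using \<open>1 / Suc n < e\<close> by simp
    qed
    then show "\<exists>n0. \<forall>n\<ge>n0. norm (?d n t - t) < e"
      by blast
  qed
  moreover have "isCont (\<lambda>t. Y t \<omega>) t"
    using cont [OF z(2)] by (simp add: continuous_on_eq_continuous_at)
  ultimately show "(\<lambda>n. case z of (t, \<omega>) \<Rightarrow> Y (?d n t) \<omega>) \<longlonglongrightarrow> (case z of (t, \<omega>) \<Rightarrow> Y t \<omega>)"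
    by (auto simp: z intro: isCont_tendsto_compose)
qed

context prob_space
begin

text \<open>The first moment method. The integrand is bounded on compact time intervals, so a functional
  that is below the threshold at \<open>T\<close> still is slightly later, and then the infimum in the definition
  of the blowup bound exceeds \<open>T\<close>. This reduces the event to one about the functional at \<open>T\<close>, to
  which Markov's inequality applies. If \<open>q = 0\<close>, the threshold is infinite and is never reached.\<close>

lemma prob_blowup_le:
  fixes N :: "real \<Rightarrow> 'a \<Rightarrow> real"
  assumes N_meas: "\<And>t. 0 \<le> t \<Longrightarrow> N t \<in> borel_measurable M"
    and N_cont: "\<And>\<omega>. \<omega> \<in> space M \<Longrightarrow> continuous_on {0..} (\<lambda>t. N t \<omega>)"
    and k: "\<And>t. 0 \<le> t \<Longrightarrow> set_integrable lborel {0..t} (\<lambda>r. (k r)\<^sup>2)"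
    and a: "\<And>t. 0 \<le> t \<Longrightarrow> set_integrable lborel {0..t} (\<lambda>r. (a r)\<^sup>2)"
    and pos: "0 < C" "0 < \<beta>" "0 < lam" "0 \<le> q" "0 < T"
    and h: "set_integrable lborel {0..T} h" "\<And>t. 0 \<le> h t"
    and bound: "\<And>t. 0 < t \<Longrightarrow> (\<integral>\<^sup>+\<omega>. ennreal (exp (- \<beta> * (lam * half_sq_int k t + half_sq_int a t)
      + \<beta> * N t \<omega>)) \<partial>M) \<le> ennreal (h t)"
  shows "\<P>(\<omega> in M. blowup_bound C \<beta> lam k a q (\<lambda>t. N t \<omega>) \<le> ereal T) \<le>
    C * \<beta> * q powr \<beta> * (LINT t:{0..T}|lborel. h t)"
proof -
  define \<kappa> where "\<kappa> t = - \<beta> * (lam * half_sq_int k t + half_sq_int a t)" for t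
  \<comment> \<open>The process is frozen before time \<open>0\<close>, so that it is continuous on the whole line.\<close>
  define w where "w r \<omega> = ennreal (exp (\<kappa> r + \<beta> * N (max 0 r) \<omega>))" for r \<omega>
  define Z where "Z t \<omega> = (\<integral>\<^sup>+r. w r \<omega> * indicator {0..t} r \<partial>lborel)" for t \<omega>
  define c where "c = ennreal (1 / (C * \<beta>)) * neg_power q \<beta>"
  have bb: "blowup_bound C \<beta> lam k a q (\<lambda>t. N t \<omega>) = Inf {ereal t | t. 0 < t \<and> c \<le> Z t \<omega>}" for \<omega>
  proof -
    have "(\<integral>\<^sup>+r\<in>{0..t}. ennreal (exp (- \<beta> * (lam * half_sq_int k r + half_sq_int a r) + \<beta> * N r \<omega>))
        \<partial>lborel) = Z t \<omega>" for t
      unfolding Z_def by (intro nn_integral_cong) (auto simp: w_def \<kappa>_def indicator_def)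
    then show ?thesis
      by (simp add: blowup_bound_def c_def)
  qed
  have [measurable]: "sq_int k \<in> borel_measurable borel" "sq_int a \<in> borel_measurable borel"
    using sq_int_mono [OF k] sq_int_mono [OF a] by (auto intro: borel_measurable_mono)
  have \<kappa>_meas [measurable]: "\<kappa> \<in> borel_measurable borel"
    unfolding \<kappa>_def half_sq_int_def by measurable
  have "(\<lambda>(t, \<omega>). N (max 0 t) \<omega>) \<in> borel_measurable (lborel \<Otimes>\<^sub>M M)"
  proof (rule continuous_process_measurable)
    fix \<omega> assume "\<omega> \<in> space M"
    then show "continuous_on UNIV (\<lambda>t. N (max 0 t) \<omega>)"
      by (intro continuous_on_compose2 [OF N_cont] continuous_intros) auto
  qed (auto intro: N_meas)
  then have w_meas [measurable]: "(\<lambda>(t, \<omega>). w t \<omega>) \<in> borel_measurable (lborel \<Otimes>\<^sub>M M)"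
    unfolding w_def split_def by measurable
  have w_meas1: "(\<lambda>r. w r \<omega>) \<in> borel_measurable lborel" if "\<omega> \<in> space M" for \<omega>
    using measurable_Pair1 [OF w_meas, of _ ] that by simp
  \<comment> \<open>The deterministic part of the exponent has the favourable sign, so only the noise has to be
    bounded on compact intervals.\<close>
  have \<kappa>_le: "\<kappa> t \<le> 0" for t
    using pos by (simp add: \<kappa>_def half_sq_int_def sq_int_nonneg)
  have w_bound: "\<exists>m. 0 \<le> m \<and> (\<forall>r\<in>{0..S}. w r \<omega> \<le> ennreal m)" if "\<omega> \<in> space M" for S \<omega>
  proof -
    have "compact ((\<lambda>t. N t \<omega>) ` {0..S})"
      by (intro compact_continuous_image continuous_on_subset [OF N_cont [OF that]]) auto
    then have "bounded ((\<lambda>t. N t \<omega>) ` {0..S})"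
      by (rule compact_imp_bounded)
    then obtain y where y: "\<And>r. r \<in> {0..S} \<Longrightarrow> \<bar>N r \<omega>\<bar> \<le> y"
      unfolding bounded_iff by (metis image_eqI real_norm_def)
    have "w r \<omega> \<le> ennreal (exp (\<beta> * y))" if "r \<in> {0..S}" for r
    proof -
      have "\<beta> * N r \<omega> \<le> \<beta> * y"
        using y [OF that] pos by (intro mult_left_mono) auto
      then show ?thesis
        using \<kappa>_le [of r] that by (simp add: w_def)
    qed
    then show ?thesis
      by (intro exI [of _ "exp (\<beta> * y)"]) simp
  qed
  have Z_extend: "\<exists>m\<ge>0. \<forall>e\<in>{0..1}. Z (T + e) \<omega> \<le> Z T \<omega> + ennreal (m * e)" if \<omega>: "\<omega> \<in> space M" for \<omega>
  proof -
    obtain m where m: "0 \<le> m" "\<And>r. r \<in> {0..T + 1} \<Longrightarrow> w r \<omega> \<le> ennreal m"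
      using w_bound [OF \<omega>] by blast
    have "Z (T + e) \<omega> \<le> Z T \<omega> + ennreal (m * e)" if e: "e \<in> {0..1}" for e
    proof -
      have "Z (T + e) \<omega> \<le> (\<integral>\<^sup>+r. w r \<omega> * indicator {0..T} r + ennreal m * indicator {T..T + e} r \<partial>lborel)"
        unfolding Z_def using e m(2) pos by (intro nn_integral_mono) (auto simp: indicator_def)
      also have "\<dots> = Z T \<omega> + ennreal m * emeasure lborel {T..T + e}"
        using w_meas1 [OF \<omega>] unfolding Z_def
        by (subst nn_integral_add) (auto simp: nn_integral_cmult_indicator)
      also have "\<dots> = Z T \<omega> + ennreal (m * e)"
        using e m(1) by (simp add: ennreal_mult')
      finally show ?thesis .
    qed
    then show ?thesis
      using m(1) by blast
  qed
  have Z_fin: "Z T \<omega> < \<infinity>" if \<omega>: "\<omega> \<in> space M" for \<omega>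
  proof -
    obtain m where m: "0 \<le> m" "\<And>r. r \<in> {0..T} \<Longrightarrow> w r \<omega> \<le> ennreal m"
      using w_bound [OF \<omega>] by blast
    have "Z T \<omega> \<le> (\<integral>\<^sup>+r. ennreal m * indicator {0..T} r \<partial>lborel)"
      unfolding Z_def using m(2) by (intro nn_integral_mono) (auto simp: indicator_def)
    also have "\<dots> = ennreal m * ennreal T"
      using pos by (simp add: nn_integral_cmult_indicator)
    also have "\<dots> < \<infinity>"
      by (simp add: ennreal_mult_less_top)
    finally show ?thesis .
  qed
  have Z_mono: "Z s \<omega> \<le> Z t \<omega>" if "s \<le> t" for s t \<omega>
    unfolding Z_def using that by (intro nn_integral_mono) (auto simp: indicator_def)
  have reach: "c \<le> Z T \<omega>" if \<omega>: "\<omega> \<in> space M" and le: "blowup_bound C \<beta> lam k a q (\<lambda>t. N t \<omega>) \<le> ereal T" for \<omega>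
  proof (rule ccontr)
    assume "\<not> c \<le> Z T \<omega>"
    then have less: "Z T \<omega> < c"
      by simp
    obtain m where m: "0 \<le> m" "\<And>e. e \<in> {0..1} \<Longrightarrow> Z (T + e) \<omega> \<le> Z T \<omega> + ennreal (m * e)"
      using Z_extend [OF \<omega>] by blast
    have "((\<lambda>e. Z T \<omega> + ennreal (m * e)) \<longlongrightarrow> Z T \<omega> + ennreal (m * 0)) (at_right 0)"
      by (intro tendsto_add tendsto_const tendsto_ennrealI tendsto_mult_left tendsto_ident_at)
    then have "((\<lambda>e. Z T \<omega> + ennreal (m * e)) \<longlongrightarrow> Z T \<omega>) (at_right 0)"
      by simp
    then have "\<forall>\<^sub>F e in at_right 0. Z T \<omega> + ennreal (m * e) < c"
      using less by (rule order_tendstoD)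
    moreover have "\<forall>\<^sub>F e in at_right 0. e \<in> {0<..<1::real}"
      by (rule eventually_at_right_real) simp
    ultimately have "\<forall>\<^sub>F e in at_right 0. 0 < e \<and> Z (T + e) \<omega> < c"
     
    proof eventually_elim
      case (elim e)
      then have "Z (T + e) \<omega> \<le> Z T \<omega> + ennreal (m * e)"
        by (intro m) auto
      then show ?case
        using elim by (auto intro: le_less_trans)
    qed
    then obtain e :: real where e: "0 < e" "Z (T + e) \<omega> < c"
      using eventually_happens trivial_limit_at_right_real by blast
    have "ereal (T + e) \<le> Inf {ereal t | t. 0 < t \<and> c \<le> Z t \<omega>}"
    proof (rule Inf_greatest)
      fix x assume "x \<in> {ereal t | t. 0 < t \<and> c \<le> Z t \<omega>}"
      then obtain t where t: "x = ereal t" "c \<le> Z t \<omega>"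
        by blast
      have "T + e \<le> t"
        using Z_mono [of t "T + e" \<omega>] t e by (meson linear leD order_trans)
      then show "ereal (T + e) \<le> x"
        by (simp add: t)
    qed
    then have "ereal (T + e) \<le> ereal T"
      using le unfolding bb by (rule order_trans)
    then show False
      using e by simp
  qed
  define K where "K = C * \<beta> * q powr \<beta>"
  have K: "0 \<le> K"
    using pos by (simp add: K_def)
  have int_nonneg: "0 \<le> (LINT t:{0..T}|lborel. h t)"
    using h(2) unfolding set_lebesgue_integral_def by (intro Bochner_Integration.integral_nonneg) auto
  have event: "\<omega> \<in> space M \<and> 1 \<le> ennreal K * Z T \<omega>"
    if \<omega>: "\<omega> \<in> space M" and le: "blowup_bound C \<beta> lam k a q (\<lambda>t. N t \<omega>) \<le> ereal T" for \<omega>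
  proof -
    have cZ: "c \<le> Z T \<omega>"
      using reach \<omega> le by blast
    have "q \<noteq> 0"
    proof
      assume "q = 0"
      then have "c = \<infinity>"
        using pos by (simp add: c_def neg_power_def ennreal_mult_top)
      then show False
        using cZ Z_fin [OF \<omega>] by simp
    qed
    then have "ennreal K * c = ennreal (K * (1 / (C * \<beta>) * q powr (- \<beta>)))"
      using K pos unfolding c_def neg_power_def
      by (simp only: if_False ennreal_mult' [symmetric] zero_le_divide_1_iff mult_nonneg_nonneg less_imp_le)
    also have "K * (1 / (C * \<beta>) * q powr (- \<beta>)) = 1"
      using pos \<open>q \<noteq> 0\<close> by (simp add: K_def powr_minus field_simps)
    finally have "1 = ennreal K * c"
      by simp
    also have "\<dots> \<le> ennreal K * Z T \<omega>"
      using cZ by (intro mult_left_mono) auto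
    finally show ?thesis
      using \<omega> by simp
  qed
  have Z_meas [measurable]: "Z T \<in> borel_measurable M"
  proof -
    have "(\<lambda>(\<omega>, r). w r \<omega> * indicator {0..T} r) \<in> borel_measurable (M \<Otimes>\<^sub>M lborel)"
    proof -
      have "(\<lambda>(\<omega>, r). w r \<omega>) \<in> borel_measurable (M \<Otimes>\<^sub>M lborel)"
        using measurable_pair_swap [OF w_meas] by (simp add: split_def)
      then show ?thesis
        unfolding split_def by measurable
    qed
    then show ?thesis
      unfolding Z_def [abs_def] by (intro sigma_finite_measure.borel_measurable_nn_integral)
        (auto simp: split_def intro: sigma_finite_lborel)
  qed
  have "emeasure M {\<omega> \<in> space M. blowup_bound C \<beta> lam k a q (\<lambda>t. N t \<omega>) \<le> ereal T} \<le>
      emeasure M {\<omega> \<in> space M. 1 \<le> ennreal K * Z T \<omega>}"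
    using event by (intro emeasure_mono) auto
  also have "\<dots> \<le> ennreal K * (\<integral>\<^sup>+\<omega>. Z T \<omega> * indicator (space M) \<omega> \<partial>M)"
    by (rule nn_integral_Markov_inequality) auto
  also have "(\<integral>\<^sup>+\<omega>. Z T \<omega> * indicator (space M) \<omega> \<partial>M) = (\<integral>\<^sup>+\<omega>. Z T \<omega> \<partial>M)"
    by (intro nn_integral_cong) simp
  also have "(\<integral>\<^sup>+\<omega>. Z T \<omega> \<partial>M) = (\<integral>\<^sup>+r. (\<integral>\<^sup>+\<omega>. w r \<omega> * indicator {0..T} r \<partial>M) \<partial>lborel)"
  proof -
    interpret pair_sigma_finite lborel M
      by (intro pair_sigma_finite.intro sigma_finite_lborel) unfold_locales
    have "(\<lambda>(r, \<omega>). w r \<omega> * indicator {0..T} r) \<in> borel_measurable (lborel \<Otimes>\<^sub>M M)"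
      using w_meas unfolding split_def by measurable
    then show ?thesis
      unfolding Z_def by (rule Fubini')
  qed
  also have "\<dots> \<le> (\<integral>\<^sup>+r. ennreal (indicator {0..T} r * h r) \<partial>lborel)"
  proof (rule nn_integral_mono_AE)
    \<comment> \<open>The moment bound is available for positive times only.\<close>
    have "AE r in lborel. r \<noteq> (0::real)"
      by (rule AE_lborel_singleton)
    then show "AE r in lborel. (\<integral>\<^sup>+\<omega>. w r \<omega> * indicator {0..T} r \<partial>M) \<le> ennreal (indicator {0..T} r * h r)"
    proof eventually_elim
      case (elim r)
      then show ?case
        using bound [of r] by (cases "r \<in> {0..T}") (auto simp: w_def \<kappa>_def)
    qed
  qed
  also have "\<dots> = ennreal (LINT t:{0..T}|lborel. h t)"
    using h unfolding set_integrable_def set_lebesgue_integral_def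
    by (subst nn_integral_eq_integral) auto
  finally have "emeasure M {\<omega> \<in> space M. blowup_bound C \<beta> lam k a q (\<lambda>t. N t \<omega>) \<le> ereal T} \<le>
      ennreal (K * (LINT t:{0..T}|lborel. h t))"
    using K by (simp add: mult_left_mono ennreal_mult')
  then show ?thesis
    using K int_nonneg by (simp add: emeasure_eq_measure K_def)
qed

end

theorem theorem5:
  fixes D :: "'d::euclidean_space set"
    and P Padj :: "real \<Rightarrow> ('d \<Rightarrow> real) \<Rightarrow> ('d \<Rightarrow> real)"
    and L Ladj :: "('d \<Rightarrow> real) rel"
    and \<phi> \<psi>\<^sub>0 \<phi>\<^sub>0 :: "'d \<Rightarrow> real"
    and g :: "real \<Rightarrow> real"
    and M :: "'w measure"
    and F :: "real \<Rightarrow> 'w measure"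
    and B BH N :: "real \<Rightarrow> 'w \<Rightarrow> real"
    and a b k :: "real \<Rightarrow> real"
    and H \<alpha> lam\<^sub>0 C \<beta> T :: real
    and \<tau> :: "'w \<Rightarrow> ereal"
  assumes "bounded_lipschitz_domain D"
    and "contraction_semigroup D P" and "L = generator D P"
    and "Ladj = adjoint_operator D L"
    and "contraction_semigroup D Padj" and "Ladj = generator D Padj"
    and "adjoint_semigroup D P Padj"
    and "has_continuous_transition_densities D P"
    and "\<phi> \<in> Linfty D" and "AE x in leb D. \<phi> x \<ge> 0"
    and "\<And>z. g z \<ge> 0" and "locally_lipschitz g"
    and "filtered_prob_space M F"
    and "1 / 2 < H" and "H < 1"
    and "brownian_motion M F B"
    and "fractional_brownian_motion M H BH" and "adapted_process F BH"
    and "continuous_on {0..} a"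
    and "\<alpha> > 1 - H" and "locally_hoelder \<alpha> b"
    and "\<And>t. t \<ge> 0 \<Longrightarrow> set_integrable lborel {0..t} (\<lambda>r. (k r)\<^sup>2)"
    and "mixed_noise M F B BH a b N"
    and "lam\<^sub>0 > 0"
    and "\<psi>\<^sub>0 \<in> Domain L" and "AE x in leb D. \<psi>\<^sub>0 x > 0" and "(LINT x|leb D. \<psi>\<^sub>0 x) = 1"
    and "\<phi>\<^sub>0 \<in> Domain Ladj" and "AE x in leb D. \<phi>\<^sub>0 x > 0" and "(LINT x|leb D. \<phi>\<^sub>0 x) = 1"
    and "\<And>t. t \<ge> 0 \<Longrightarrow> AE x in leb D. P t \<psi>\<^sub>0 x = exp (- lam\<^sub>0 * t) * \<psi>\<^sub>0 x"
    and "\<And>t. t \<ge> 0 \<Longrightarrow> AE x in leb D. Padj t \<phi>\<^sub>0 x = exp (- lam\<^sub>0 * t) * \<phi>\<^sub>0 x"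
    and "C > 0" and "\<beta> > 0" and "\<And>z. z > 0 \<Longrightarrow> g z \<ge> C * z powr (1 + \<beta>)"
    and "\<And>\<omega>. \<tau> \<omega> = blowup_bound C \<beta> lam\<^sub>0 k a (ip D \<phi> \<phi>\<^sub>0) (\<lambda>t. N t \<omega>)"
    and "T > 0"
  shows "((\<exists>W. brownian_motion M F W \<and>
            (\<forall>t\<ge>0. has_ito_integral M F W t (\<lambda>s \<omega>. K_fbm H t s) (BH t))) \<longrightarrow>
         \<P>(\<omega> in M. \<tau> \<omega> \<le> ereal T) \<le>
           C * \<beta> * ip D \<phi> \<phi>\<^sub>0 powr \<beta> *
             (LINT t:{0..T}|lborel.
                exp (- \<beta> * lam\<^sub>0 * sq_int k t + 2 * \<beta>\<^sup>2 * sq_int a t) +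
                exp (- \<beta> * sq_int a t + 4 * \<beta>\<^sup>2 * H * t powr (2 * H - 1) * sq_int b t))) \<and>
         (independent_processes M B BH \<longrightarrow>
         \<P>(\<omega> in M. \<tau> \<omega> \<le> ereal T) \<le>
           C * \<beta> * ip D \<phi> \<phi>\<^sub>0 powr \<beta> *
             (LINT t:{0..T}|lborel.
                exp (- \<beta> * lam\<^sub>0 * half_sq_int k t + (\<beta>\<^sup>2 - \<beta>) / 2 * sq_int a t +
                     \<beta>\<^sup>2 * H * t powr (2 * H - 1) * sq_int b t)))"
proof -
  note filt = \<open>filtered_prob_space M F\<close> and bm = \<open>brownian_motion M F B\<close>
    and fbm = \<open>fractional_brownian_motion M H BH\<close> and H = \<open>1 / 2 < H\<close> \<open>H < 1\<close>
    and pos = \<open>C > 0\<close> \<open>\<beta> > 0\<close> \<open>lam\<^sub>0 > 0\<close> \<open>T > 0\<close>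
    and k_int = \<open>\<And>t. t \<ge> 0 \<Longrightarrow> set_integrable lborel {0..t} (\<lambda>r. (k r)\<^sup>2)\<close>
    and \<tau> = \<open>\<And>\<omega>. \<tau> \<omega> = blowup_bound C \<beta> lam\<^sub>0 k a (ip D \<phi> \<phi>\<^sub>0) (\<lambda>t. N t \<omega>)\<close>
    and noise = \<open>mixed_noise M F B BH a b N\<close>
  interpret prob_space M
    using filt by (simp add: filtered_prob_space_def)
  have q: "0 \<le> ip D \<phi> \<phi>\<^sub>0"
  proof -
    have "AE x in leb D. 0 \<le> \<phi> x * \<phi>\<^sub>0 x"
      using \<open>AE x in leb D. \<phi> x \<ge> 0\<close> \<open>AE x in leb D. \<phi>\<^sub>0 x > 0\<close> by eventually_elim simp
    then show ?thesis
      unfolding ip_def by (rule integral_nonneg_AE)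
  qed
  have a: "continuous_on {0..t} a" for t
    using \<open>continuous_on {0..} a\<close> by (rule continuous_on_subset) auto
  have b: "continuous_on {0..t} b" for t
    using \<open>locally_hoelder \<alpha> b\<close> \<open>\<alpha> > 1 - H\<close> H by (intro locally_hoelder_continuous_on) auto
  have a_int: "set_integrable lborel {0..t} (\<lambda>r. (a r)\<^sup>2)"
    and b_int: "set_integrable lborel {0..t} (\<lambda>r. (b r)\<^sup>2)" for t
    by (intro set_integrable_square_of_continuous a b)+
  have sq_int_monos: "mono (sq_int k)" "mono (sq_int a)" "mono (sq_int b)"
    using sq_int_mono [OF k_int] sq_int_mono [OF a_int] sq_int_mono [OF b_int] by blast+
  then have [measurable]: "sq_int k \<in> borel_measurable borel" "sq_int a \<in> borel_measurable borel"
    "sq_int b \<in> borel_measurable borel"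
    by (auto intro: borel_measurable_mono)
  have sq_le: "sq_int a t \<le> sq_int a T" "sq_int b t \<le> sq_int b T" if "t \<in> {0..T}" for t
    using sq_int_monos that by (auto intro: monoD)
  obtain I J where N_meas: "\<And>t. 0 \<le> t \<Longrightarrow> N t \<in> borel_measurable M"
    and N_cont: "\<And>\<omega>. \<omega> \<in> space M \<Longrightarrow> continuous_on {0..} (\<lambda>t. N t \<omega>)"
    and IJ: "\<And>t. 0 \<le> t \<Longrightarrow> has_ito_integral M F B t (\<lambda>s \<omega>. a s) (I t)"
      "\<And>t. 0 \<le> t \<Longrightarrow> AE \<omega> in M. has_rs_integral b (\<lambda>s. BH s \<omega>) 0 t (J t \<omega>)"
      "\<And>t. 0 \<le> t \<Longrightarrow> AE \<omega> in M. N t \<omega> = I t \<omega> + J t \<omega>"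
    using noise unfolding mixed_noise_def by blast
  have I_meas: "I t \<in> borel_measurable M" if "0 \<le> t" for t
    using IJ(1) [OF that] by (simp add: has_ito_integral_def)
  note blowup = prob_blowup_le [OF N_meas N_cont k_int a_int pos(1,2,3) q pos(4), folded \<tau>]
  have powr_le: "\<gamma> * t powr (2 * H - 1) * sq_int b t \<le> \<gamma> * T powr (2 * H - 1) * sq_int b T"
    if "0 \<le> \<gamma>" "t \<in> {0..T}" for \<gamma> t
    using that H sq_le sq_int_nonneg by (intro mult_mono powr_mono2) auto
  have part1: "\<P>(\<omega> in M. \<tau> \<omega> \<le> ereal T) \<le> C * \<beta> * ip D \<phi> \<phi>\<^sub>0 powr \<beta> *
      (LINT t:{0..T}|lborel. exp (- \<beta> * lam\<^sub>0 * sq_int k t + 2 * \<beta>\<^sup>2 * sq_int a t) +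
        exp (- \<beta> * sq_int a t + 4 * \<beta>\<^sup>2 * H * t powr (2 * H - 1) * sq_int b t))"
  proof (rule blowup)
    show "set_integrable lborel {0..T} (\<lambda>t. exp (- \<beta> * lam\<^sub>0 * sq_int k t + 2 * \<beta>\<^sup>2 * sq_int a t) +
        exp (- \<beta> * sq_int a t + 4 * \<beta>\<^sup>2 * H * t powr (2 * H - 1) * sq_int b t))"
    proof (intro set_integral_add set_integrable_exp_bounded_above)
      fix t assume t: "t \<in> {0..T}"
      have "- \<beta> * lam\<^sub>0 * sq_int k t \<le> 0" "2 * \<beta>\<^sup>2 * sq_int a t \<le> 2 * \<beta>\<^sup>2 * sq_int a T"
        using pos sq_le [OF t] by (auto simp: sq_int_nonneg intro!: mult_left_mono)
      then show "- \<beta> * lam\<^sub>0 * sq_int k t + 2 * \<beta>\<^sup>2 * sq_int a t \<le> 2 * \<beta>\<^sup>2 * sq_int a T"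
        by linarith
      have "- \<beta> * sq_int a t \<le> 0"
        using pos by (simp add: sq_int_nonneg)
      moreover have "4 * \<beta>\<^sup>2 * H * t powr (2 * H - 1) * sq_int b t \<le>
          4 * \<beta>\<^sup>2 * H * T powr (2 * H - 1) * sq_int b T"
        using H t by (intro powr_le) auto
      ultimately show "- \<beta> * sq_int a t + 4 * \<beta>\<^sup>2 * H * t powr (2 * H - 1) * sq_int b t \<le>
          4 * \<beta>\<^sup>2 * H * T powr (2 * H - 1) * sq_int b T"
        by linarith
    qed measurable
    fix t :: real assume t: "0 < t"
    \<comment> \<open>The drift is split so that \<open>exp (2 x)\<close> carries \<open>k\<close> with \<open>B\<close>, and \<open>exp (2 y)\<close> carries
      \<open>A\<close> with \<open>B\<^sup>H\<close>.\<close>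
    define x where "x \<omega> = - \<beta> * lam\<^sub>0 * sq_int k t / 2 + \<beta> * I t \<omega>" for \<omega>
    \<comment> \<open>Writing \<open>N t - I t\<close> for the Stieltjes integral gives a measurable version of it.\<close>
    define y where "y \<omega> = - \<beta> * sq_int a t / 2 + \<beta> * (N t \<omega> - I t \<omega>)" for \<omega>
    have [measurable]: "N t \<in> borel_measurable M" "I t \<in> borel_measurable M"
      using t by (auto intro: N_meas I_meas)
    have [measurable]: "x \<in> borel_measurable M" "y \<in> borel_measurable M"
      unfolding x_def y_def by measurable
    have "(\<integral>\<^sup>+\<omega>. ennreal (exp (- \<beta> * (lam\<^sub>0 * half_sq_int k t + half_sq_int a t) + \<beta> * N t \<omega>)) \<partial>M) \<le>
        (\<integral>\<^sup>+\<omega>. ennreal (exp (2 * x \<omega>)) + ennreal (exp (2 * y \<omega>)) \<partial>M)"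
    proof (rule nn_integral_mono)
      fix \<omega>
      have "- \<beta> * (lam\<^sub>0 * half_sq_int k t + half_sq_int a t) + \<beta> * N t \<omega> = x \<omega> + y \<omega>"
        by (simp add: x_def y_def half_sq_int_def algebra_simps)
      moreover have "exp (x \<omega> + y \<omega>) \<le> exp (2 * x \<omega>) + exp (2 * y \<omega>)"
      proof -
        have "x \<omega> + y \<omega> \<le> 2 * x \<omega> \<or> x \<omega> + y \<omega> \<le> 2 * y \<omega>"
          by linarith
        then have "exp (x \<omega> + y \<omega>) \<le> exp (2 * x \<omega>) \<or> exp (x \<omega> + y \<omega>) \<le> exp (2 * y \<omega>)"
          by simp
        then show ?thesis
          using exp_ge_zero [of "2 * x \<omega>"] exp_ge_zero [of "2 * y \<omega>"] by linarith
      qed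
      ultimately show "ennreal (exp (- \<beta> * (lam\<^sub>0 * half_sq_int k t + half_sq_int a t) + \<beta> * N t \<omega>)) \<le>
          ennreal (exp (2 * x \<omega>)) + ennreal (exp (2 * y \<omega>))"
        by (simp flip: ennreal_plus)
    qed
    also have "\<dots> = (\<integral>\<^sup>+\<omega>. ennreal (exp (2 * x \<omega>)) \<partial>M) + (\<integral>\<^sup>+\<omega>. ennreal (exp (2 * y \<omega>)) \<partial>M)"
      by (intro nn_integral_add) measurable
    also have "(\<integral>\<^sup>+\<omega>. ennreal (exp (2 * x \<omega>)) \<partial>M) \<le>
        ennreal (exp (- \<beta> * lam\<^sub>0 * sq_int k t + 2 * \<beta>\<^sup>2 * sq_int a t))"
    proof -
      have "(\<integral>\<^sup>+\<omega>. ennreal (exp (2 * x \<omega>)) \<partial>M) =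
          (\<integral>\<^sup>+\<omega>. ennreal (exp (- \<beta> * lam\<^sub>0 * sq_int k t)) * ennreal (exp ((2 * \<beta>) * I t \<omega>)) \<partial>M)"
        by (intro nn_integral_cong) (simp add: x_def exp_add [symmetric] ennreal_mult' [symmetric] distrib_left)
      also have "\<dots> = ennreal (exp (- \<beta> * lam\<^sub>0 * sq_int k t)) * (\<integral>\<^sup>+\<omega>. ennreal (exp ((2 * \<beta>) * I t \<omega>)) \<partial>M)"
        by (intro nn_integral_cmult) measurable
      also have "\<dots> \<le> ennreal (exp (- \<beta> * lam\<^sub>0 * sq_int k t)) * ennreal (exp ((2 * \<beta>)\<^sup>2 / 2 * sq_int a t))"
        using t by (intro mult_left_mono ito_exp_le [OF filt bm IJ(1) a]) auto
      also have "\<dots> = ennreal (exp (- \<beta> * lam\<^sub>0 * sq_int k t + 2 * \<beta>\<^sup>2 * sq_int a t))"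
        by (simp add: exp_add [symmetric] ennreal_mult' [symmetric] power_mult_distrib)
      finally show ?thesis .
    qed
    also have "(\<integral>\<^sup>+\<omega>. ennreal (exp (2 * y \<omega>)) \<partial>M) \<le>
        ennreal (exp (- \<beta> * sq_int a t + 4 * \<beta>\<^sup>2 * H * t powr (2 * H - 1) * sq_int b t))"
    proof -
      have rs: "AE \<omega> in M. has_rs_integral b (\<lambda>s. BH s \<omega>) 0 t (N t \<omega> - I t \<omega>)"
        using IJ(2,3) [of t] t by (auto elim: eventually_elim2)
      have "(\<integral>\<^sup>+\<omega>. ennreal (exp (2 * y \<omega>)) \<partial>M) =
          (\<integral>\<^sup>+\<omega>. ennreal (exp (- \<beta> * sq_int a t)) * ennreal (exp ((2 * \<beta>) * (N t \<omega> - I t \<omega>))) \<partial>M)"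
        by (intro nn_integral_cong) (simp add: y_def exp_add [symmetric] ennreal_mult' [symmetric] distrib_left)
      also have "\<dots> = ennreal (exp (- \<beta> * sq_int a t)) *
          (\<integral>\<^sup>+\<omega>. ennreal (exp ((2 * \<beta>) * (N t \<omega> - I t \<omega>))) \<partial>M)"
        by (intro nn_integral_cmult) measurable
      also have "\<dots> \<le> ennreal (exp (- \<beta> * sq_int a t)) *
          ennreal (exp ((2 * \<beta>)\<^sup>2 * H * t powr (2 * H - 1) * sq_int b t))"
        using t by (intro mult_left_mono fbm_stieltjes_exp_le [OF fbm H(1) b _ rs]) auto
      also have "\<dots> = ennreal (exp (- \<beta> * sq_int a t + 4 * \<beta>\<^sup>2 * H * t powr (2 * H - 1) * sq_int b t))"
        by (simp add: exp_add [symmetric] ennreal_mult' [symmetric] power_mult_distrib)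
      finally show ?thesis .
    qed
    finally show "(\<integral>\<^sup>+\<omega>. ennreal (exp (- \<beta> * (lam\<^sub>0 * half_sq_int k t + half_sq_int a t) + \<beta> * N t \<omega>)) \<partial>M) \<le>
        ennreal (exp (- \<beta> * lam\<^sub>0 * sq_int k t + 2 * \<beta>\<^sup>2 * sq_int a t) +
          exp (- \<beta> * sq_int a t + 4 * \<beta>\<^sup>2 * H * t powr (2 * H - 1) * sq_int b t))"
      by (simp add: add_mono ennreal_plus)
  qed (assumption+, intro add_nonneg_nonneg exp_ge_zero)
  have part2: "\<P>(\<omega> in M. \<tau> \<omega> \<le> ereal T) \<le> C * \<beta> * ip D \<phi> \<phi>\<^sub>0 powr \<beta> *
      (LINT t:{0..T}|lborel. exp (- \<beta> * lam\<^sub>0 * half_sq_int k t + (\<beta>\<^sup>2 - \<beta>) / 2 * sq_int a t +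
        \<beta>\<^sup>2 * H * t powr (2 * H - 1) * sq_int b t))"
    if indep: "independent_processes M B BH"
  proof (rule blowup)
    show "set_integrable lborel {0..T} (\<lambda>t. exp (- \<beta> * lam\<^sub>0 * half_sq_int k t +
        (\<beta>\<^sup>2 - \<beta>) / 2 * sq_int a t + \<beta>\<^sup>2 * H * t powr (2 * H - 1) * sq_int b t))"
    proof (rule set_integrable_exp_bounded_above)
      show "(\<lambda>t. - \<beta> * lam\<^sub>0 * half_sq_int k t + (\<beta>\<^sup>2 - \<beta>) / 2 * sq_int a t +
          \<beta>\<^sup>2 * H * t powr (2 * H - 1) * sq_int b t) \<in> borel_measurable borel"
        unfolding half_sq_int_def by measurable
      fix t assume t: "t \<in> {0..T}"
      have "- \<beta> * lam\<^sub>0 * half_sq_int k t \<le> 0"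
        using pos by (simp add: half_sq_int_def sq_int_nonneg)
      moreover have "(\<beta>\<^sup>2 - \<beta>) / 2 * sq_int a t \<le> \<bar>(\<beta>\<^sup>2 - \<beta>) / 2\<bar> * sq_int a T"
        using sq_le [OF t] sq_int_nonneg by (intro mult_mono abs_ge_self) auto
      moreover have "\<beta>\<^sup>2 * H * t powr (2 * H - 1) * sq_int b t \<le>
          \<beta>\<^sup>2 * H * T powr (2 * H - 1) * sq_int b T"
        using H t by (intro powr_le) auto
      ultimately show "- \<beta> * lam\<^sub>0 * half_sq_int k t + (\<beta>\<^sup>2 - \<beta>) / 2 * sq_int a t +
          \<beta>\<^sup>2 * H * t powr (2 * H - 1) * sq_int b t \<le>
          \<bar>(\<beta>\<^sup>2 - \<beta>) / 2\<bar> * sq_int a T + \<beta>\<^sup>2 * H * T powr (2 * H - 1) * sq_int b T"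
        by linarith
    qed
    fix t :: real assume t: "0 < t"
    have [measurable]: "N t \<in> borel_measurable M" "I t \<in> borel_measurable M"
      using t by (auto intro: N_meas I_meas)
    define c where "c = - \<beta> * (lam\<^sub>0 * half_sq_int k t + half_sq_int a t)"
    have rs: "AE \<omega> in M. has_rs_integral b (\<lambda>s. BH s \<omega>) 0 t (N t \<omega> - I t \<omega>)"
      using IJ(2,3) [of t] t by (auto elim: eventually_elim2)
    have "(\<integral>\<^sup>+\<omega>. ennreal (exp (c + \<beta> * N t \<omega>)) \<partial>M) =
        (\<integral>\<^sup>+\<omega>. ennreal (exp c) * ennreal (exp (\<beta> * (I t \<omega> + (N t \<omega> - I t \<omega>)))) \<partial>M)"
      by (intro nn_integral_cong) (simp add: exp_add [symmetric] ennreal_mult' [symmetric])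
    also have "\<dots> = ennreal (exp c) * (\<integral>\<^sup>+\<omega>. ennreal (exp (\<beta> * (I t \<omega> + (N t \<omega> - I t \<omega>)))) \<partial>M)"
      by (intro nn_integral_cmult) measurable
    also have "\<dots> \<le> ennreal (exp c) *
        ennreal (exp (\<beta>\<^sup>2 / 2 * sq_int a t + \<beta>\<^sup>2 * H * t powr (2 * H - 1) * sq_int b t))"
      using t by (intro mult_left_mono
          ito_stieltjes_exp_le_indep [OF filt bm IJ(1) a _ fbm H(1) b rs indep]) auto
    also have "\<dots> = ennreal (exp (- \<beta> * lam\<^sub>0 * half_sq_int k t + (\<beta>\<^sup>2 - \<beta>) / 2 * sq_int a t +
        \<beta>\<^sup>2 * H * t powr (2 * H - 1) * sq_int b t))"
    proof -
      have "c + (\<beta>\<^sup>2 / 2 * sq_int a t + \<beta>\<^sup>2 * H * t powr (2 * H - 1) * sq_int b t) =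
          - \<beta> * lam\<^sub>0 * half_sq_int k t + (\<beta>\<^sup>2 - \<beta>) / 2 * sq_int a t +
          \<beta>\<^sup>2 * H * t powr (2 * H - 1) * sq_int b t"
        by (simp add: c_def half_sq_int_def algebra_simps diff_divide_distrib)
      then show ?thesis
        by (simp only: ennreal_mult' [symmetric] exp_add [symmetric] exp_ge_zero)
    qed
    finally show "(\<integral>\<^sup>+\<omega>. ennreal (exp (- \<beta> * (lam\<^sub>0 * half_sq_int k t + half_sq_int a t) + \<beta> * N t \<omega>)) \<partial>M) \<le>
        ennreal (exp (- \<beta> * lam\<^sub>0 * half_sq_int k t + (\<beta>\<^sup>2 - \<beta>) / 2 * sq_int a t +
          \<beta>\<^sup>2 * H * t powr (2 * H - 1) * sq_int b t))"
      unfolding c_def .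
  qed (assumption+, rule exp_ge_zero)
  show ?thesis
    using part1 part2 by blast
qed

end
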